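(* Let $f:\mathbb{R}^D\to\mathbb{R}$ be Lipschitz continuous with constant $L>0$ ($|f(x)-f(y)|\le L\|x-y\|_2$ for all $x,y$) and have effective dimension $d_e<D$, with effective subspace spanned by the columns of the orthonormal matrix $U\in\mathbb{R}^{D\times d_e}$. Let $1\le d<d_e$, let $\epsilon>0$, let $A$ be a $D\times d$ Gaussian matrix, and let $x^*$ be any global minimizer of $f$ over $\mathbb{R}^D$. Let $R_{\max}>\epsilon/L$ be a constant, let $p\in\mathbb{R}^D$ be a given vector that satisfies $\|U^Tp-U^Tx^*\|\le R_{\max}$, and let $r_{\min}^{\mathrm{eff}}:=\epsilon/(LR_{\max})$. Then $$\mathbb{P}[(\mathrm{RP}\mathcal{X})\ \text{is}\ \epsilon\text{-successful}]\ \ge\ \tau(r_{\min}^{\mathrm{eff}},d,d_e).$$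
   Context: Here $\mathcal{X}=\mathbb{R}^D$, $f^*:=\min_{x\in\mathbb{R}^D}f(x)$ (attained). A function $f:\mathbb{R}^D\to\mathbb{R}$ has effective dimension $d_e<D$ if there exists a linear subspace $\mathcal{T}$ (the effective subspace) of dimension $d_e$ such that $f(x_\top+x_\perp)=f(x_\top)$ for all $x_\top\in\mathcal{T}$ and $x_\perp\in\mathcal{T}^\perp$, and $d_e$ is the smallest integer with this property. A Gaussian matrix has independent standard normal entries. The reduced problem $(\mathrm{RP}\mathcal{X})$ is $\min_{y\in\mathbb{R}^d}f(Ay+p)$; it is $\epsilon$-successful if there exists $y\in\mathbb{R}^d$ with $f(Ay+p)\le f^*+\epsilon$. For $0<r<1$ and integers $1\le d<N$, $$\tau(r,d,N):=\begin{cases}(N-1)\binom{\frac{N-2}{2}}{\frac{N-1}{2}}\displaystyle\int_0^{\arcsin(r)}\sin^{N-2}(x)\,dx & \text{if } d=1,\\[2mm] \binom{\frac{N-2}{2}}{\frac{N-d}{2}}\,r^{N-d}(1-r^2)^{\frac{d-2}{2}} & \text{if } 1<d<N,\end{cases}$$ where $\binom{i}{j}=\frac{\Gamma(i+1)}{\Gamma(j+1)\Gamma(i-j+1)}$ for real $i,j$. *)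

theory Defs
  imports "HOL-Probability.Probability"
begin

definition varies_only_along :: "('a::euclidean_space \<Rightarrow> real) \<Rightarrow> 'a set \<Rightarrow> bool" where
  "varies_only_along f T \<longleftrightarrow>
     subspace T \<and> (\<forall>x\<in>T. \<forall>y\<in>orthogonal_comp T. f (x + y) = f x)"

definition has_effective_dimension :: "('a::euclidean_space \<Rightarrow> real) \<Rightarrow> nat \<Rightarrow> bool" where
  "has_effective_dimension f k \<longleftrightarrow>
     (\<exists>T. varies_only_along f T \<and> dim T = k) \<and>
     (\<forall>T. varies_only_along f T \<longrightarrow> k \<le> dim T)"

definition effective_subspace :: "('a::euclidean_space \<Rightarrow> real) \<Rightarrow> 'a set \<Rightarrow> bool" where
  "effective_subspace f T \<longleftrightarrow> varies_only_along f T \<and> has_effective_dimension f (dim T)"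

text \<open>The indices of \<open>indep_vars\<close> are all matrix positions, so the entries are jointly independent
  (and in particular measurable).\<close>

definition gaussian_matrix :: "'w measure \<Rightarrow> ('w \<Rightarrow> real ^ 'd ^ 'n) \<Rightarrow> bool" where
  "gaussian_matrix M A \<longleftrightarrow>
     prob_space.indep_vars M (\<lambda>_. borel) (\<lambda>(i, j) \<omega>. A \<omega> $ i $ j) (UNIV :: ('n \<times> 'd) set) \<and>
     (\<forall>i j. distributed M lborel (\<lambda>\<omega>. A \<omega> $ i $ j) (\<lambda>x. ennreal (std_normal_density x)))"

text \<open>For the unconstrained problem \<open>f\<^sup>* = min f\<close>; the infimum is the minimum whenever \<open>f\<close> has a
  global minimizer, and should only be used in that case.\<close>

definition rp_successful ::
    "real \<Rightarrow> (real ^ 'n \<Rightarrow> real) \<Rightarrow> real ^ 'd ^ 'n \<Rightarrow> real ^ 'n \<Rightarrow> bool" where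
  "rp_successful \<epsilon> f A p \<longleftrightarrow> (\<exists>y. f (A *v y + p) \<le> (INF x. f x) + \<epsilon>)"

text \<open>The library's \<open>gchoose\<close> requires a natural number below, hence the Gamma-function version.\<close>

definition real_binomial :: "real \<Rightarrow> real \<Rightarrow> real" where
  "real_binomial i j = Gamma (i + 1) / (Gamma (j + 1) * Gamma (i - j + 1))"

text \<open>Meaningful only for \<open>0 < r < 1\<close> and \<open>1 \<le> d < N\<close>.\<close>

definition tau :: "real \<Rightarrow> nat \<Rightarrow> nat \<Rightarrow> real" where
  "tau r d N =
     (if d = 1 then
        (real N - 1) * real_binomial ((real N - 2) / 2) ((real N - 1) / 2) *
          integral {0..arcsin r} (\<lambda>x. sin x ^ (N - 2))
      else
        real_binomial ((real N - 2) / 2) ((real N - real d) / 2) *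
          r ^ (N - d) * (1 - r\<^sup>2) powr ((real d - 2) / 2))"

end

theory Submission
  imports Defs
begin

text \<open>
  Since \<open>f\<close> depends only on the projection onto the effective subspace and is Lipschitz, success is
  implied by \<open>\<parallel>B y - z\<parallel> \<le> r \<parallel>z\<parallel>\<close> for some \<open>y\<close>, where \<open>B = U\<^sup>T A\<close>, \<open>z = U\<^sup>T (x\<^sup>* - p)\<close> and
  \<open>r = \<epsilon> / (L Rmax)\<close>. The matrix \<open>B\<close> is again Gaussian, so by rotation invariance the probability of
  this event is the same for all \<open>z \<noteq> 0\<close>, and \<open>z\<close> may be replaced by an independent Gaussian vector
  \<open>g\<close>. For fixed \<open>B\<close>, almost surely of full rank \<open>d\<close>, the event says that the \<open>N - d\<close> coordinates of
  \<open>g\<close> orthogonal to the range of \<open>B\<close> have norm at most \<open>r \<parallel>g\<parallel>\<close>. The two coordinate norms are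
  independent and chi distributed, and in polar coordinates the probability becomes
  \<open>(N - d) binom((N - 2) / 2, (N - d) / 2) \<integral> sin\<^bsup>N-d-1\<^esup> cos\<^bsup>d-1\<^esup>\<close> over \<open>[0, arcsin r]\<close>. This is
  \<open>\<tau>\<close> for \<open>d = 1\<close>, and for \<open>d \<ge> 2\<close> the bound \<open>cos \<ge> (1 - r\<^sup>2)\<^bsup>1/2\<^esup>\<close> gives \<open>\<tau>\<close>.
\<close>

section \<open>Rotation invariance of Lebesgue measure\<close>

text \<open>By Fubini and the substitutions \<open>x \<mapsto> y + x\<close> and \<open>y \<mapsto> y - x\<close>, \<open>\<mu>(A) \<lambda>(C) = \<lambda>(A) \<mu>(-C)\<close>, where
  \<open>C\<close> is the unit ball.\<close>

lemma translation_invariant_measure_unique: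
  fixes \<mu> :: "'a::euclidean_space measure"
  assumes sets: "sets \<mu> = sets borel" and sf: "sigma_finite_measure \<mu>"
    and inv: "\<And>a. distr \<mu> borel ((+) a) = \<mu>"
    and ball: "emeasure \<mu> (cball 0 1) = emeasure lborel (cball (0::'a) 1)"
  shows "\<mu> = lborel"
proof (rule measure_eqI)
  fix A assume "A \<in> sets \<mu>"
  note sets[simp, measurable_cong]
  with \<open>A \<in> sets \<mu>\<close> have A[measurable]: "A \<in> sets borel" by simp
  interpret mu: sigma_finite_measure \<mu> by (rule sf)
  interpret pair_sigma_finite \<mu> lborel ..
  define C where "C = cball (0::'a) 1"
  have [measurable]: "C \<in> sets borel" by (simp add: C_def)
  have shift: "(\<integral>\<^sup>+x. f x \<partial>\<mu>) = (\<integral>\<^sup>+x. f (a + x) \<partial>\<mu>)" if [measurable]: "f \<in> borel_measurable borel" for a and f :: "'a \<Rightarrow> ennreal"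
    by (subst inv[of a, symmetric]) (simp add: nn_integral_distr)
  have shiftl: "(\<integral>\<^sup>+x. f x \<partial>lborel) = (\<integral>\<^sup>+x. f (a + x) \<partial>lborel)" if [measurable]: "f \<in> borel_measurable borel" for a and f :: "'a \<Rightarrow> ennreal"
    by (subst lborel_distr_plus[of a, symmetric]) (simp add: nn_integral_distr)
  have "emeasure \<mu> A * emeasure lborel C = (\<integral>\<^sup>+y. (\<integral>\<^sup>+x. indicator A x * indicator C y \<partial>\<mu>) \<partial>lborel)"
    by (simp add: nn_integral_multc nn_integral_cmult_indicator)
  also have "\<dots> = (\<integral>\<^sup>+y. (\<integral>\<^sup>+x. indicator A (y + x) * indicator C y \<partial>\<mu>) \<partial>lborel)"
    by (intro nn_integral_cong shift) measurable
  also have "\<dots> = (\<integral>\<^sup>+x. (\<integral>\<^sup>+y. indicator A (y + x) * indicator C y \<partial>lborel) \<partial>\<mu>)"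
    by (rule Fubini') measurable
  also have "\<dots> = (\<integral>\<^sup>+x. (\<integral>\<^sup>+y. indicator A y * indicator C (y - x) \<partial>lborel) \<partial>\<mu>)"
  proof (rule nn_integral_cong)
    fix x
    show "(\<integral>\<^sup>+y. indicator A (y + x) * indicator C y \<partial>lborel) = (\<integral>\<^sup>+y. indicator A y * indicator C (y - x) \<partial>lborel)"
      using shiftl[of "\<lambda>y. indicator A (y + x) * indicator C y" "- x"] by simp
  qed
  also have "\<dots> = (\<integral>\<^sup>+y. (\<integral>\<^sup>+x. indicator A y * indicator C (y - x) \<partial>\<mu>) \<partial>lborel)"
    by (rule Fubini'[symmetric]) measurable
  also have "\<dots> = (\<integral>\<^sup>+y. indicator A y * emeasure \<mu> C \<partial>lborel)"
  proof (rule nn_integral_cong)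
    fix y
    have "(\<integral>\<^sup>+x. indicator A y * indicator C (y - x) \<partial>\<mu>) = (\<integral>\<^sup>+x. indicator A y * indicator C (y - (y + x)) \<partial>\<mu>)"
      by (rule shift) measurable
    \<comment> \<open>The ball \<open>C\<close> is symmetric about the origin, so \<open>-C\<close>
      and \<open>C\<close> have the same measure.\<close>
    also have "\<dots> = (\<integral>\<^sup>+x. indicator A y * indicator C x \<partial>\<mu>)"
      by (intro nn_integral_cong) (simp add: indicator_def C_def)
    finally show "(\<integral>\<^sup>+x. indicator A y * indicator C (y - x) \<partial>\<mu>) = indicator A y * emeasure \<mu> C"
      by (simp add: nn_integral_cmult)
  qed
  also have "\<dots> = emeasure lborel A * emeasure lborel C"
    by (simp add: nn_integral_multc ball C_def)
  finally have "emeasure \<mu> A * emeasure lborel C = emeasure lborel A * emeasure lborel C" .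
  moreover have "emeasure lborel C \<noteq> 0" "emeasure lborel C \<noteq> \<infinity>"
    using emeasure_lborel_cball_finite[of "0::'a" 1]
    by (auto simp: C_def emeasure_cball less_imp_neq[symmetric] intro!: ennreal_less_top)
  ultimately show "emeasure \<mu> A = emeasure lborel A"
    by (simp add: mult.commute[of _ "emeasure lborel C"] ennreal_mult_cancel_left)
qed (simp add: sets)

text \<open>Translating by \<open>a\<close> after \<open>Q\<close> amounts to translating by the
  preimage of \<open>a\<close> before \<open>Q\<close>, and \<open>Q\<close> maps the unit ball onto
  itself. So the pushforward is characterized as Lebesgue measure by translation invariance.\<close>

lemma distr_lborel_orthogonal:
  fixes Q :: "'a::euclidean_space \<Rightarrow> 'a"
  assumes Q: "orthogonal_transformation Q"
  shows "distr lborel borel Q = lborel"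
proof (rule translation_invariant_measure_unique)
  have lin: "linear Q" using Q by (rule orthogonal_transformation_linear)
  have [measurable]: "Q \<in> borel_measurable borel"
    using lin by (simp add: borel_measurable_continuous_onI linear_continuous_on linear_conv_bounded_linear)
  have norm: "norm (Q x) = norm x" for x using Q by (rule orthogonal_transformation_norm)
  obtain R where R: "orthogonal_transformation R" "\<And>x. Q (R x) = x"
    using Q orthogonal_transformation_inv orthogonal_transformation_surj by (metis surj_f_inv_f)
  have pre: "Q -` cball 0 1 = cball 0 1" by (auto simp: norm)
  show "emeasure (distr lborel borel Q) (cball 0 1) = emeasure lborel (cball (0::'a) 1)"
    by (simp add: emeasure_distr pre)
  show "sigma_finite_measure (distr lborel borel Q)"
  proof
    have "Q -` cball 0 (real n) = cball 0 (real n)" for n by (auto simp: norm)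
    then have "emeasure (distr lborel borel Q) (cball 0 (real n)) \<noteq> \<infinity>" for n
      by (simp add: emeasure_distr emeasure_cball)
    then show "\<exists>A. countable A \<and> A \<subseteq> sets (distr lborel borel Q) \<and> \<Union> A = space (distr lborel borel Q) \<and>
        (\<forall>a\<in>A. emeasure (distr lborel borel Q) a \<noteq> \<infinity>)"
      by (intro exI[of _ "range (\<lambda>n::nat. cball 0 (real n))"]) (auto intro: real_arch_simple)
  qed
  fix a
  have "distr (distr lborel borel Q) borel ((+) a) = distr lborel borel (\<lambda>x. Q (R a + x))"
    using R by (simp add: distr_distr comp_def linear_add[OF lin])
  also have "\<dots> = distr (distr lborel borel ((+) (R a))) borel Q"
    by (simp add: distr_distr comp_def)
  finally show "distr (distr lborel borel Q) borel ((+) a) = distr lborel borel Q"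
    by (simp add: lborel_distr_plus)
qed simp

section \<open>The norm of a Gaussian vector\<close>

text \<open>Joint density of \<open>n\<close> independent standard normals at a point of norm
  \<open>s\<close>. Writing it through the norm makes rotation invariance visible; with
  \<open>n\<close> as a parameter, weights multiply when dimensions and squared norms add.\<close>

definition gauss_weight :: "nat \<Rightarrow> real \<Rightarrow> real" where
  "gauss_weight n s = (1 / sqrt (2 * pi)) ^ n * exp (- s\<^sup>2 / 2)"

lemma gauss_weight_nonneg [simp]: "0 \<le> gauss_weight n s"
  by (simp add: gauss_weight_def)

lemma borel_measurable_gauss_weight [measurable]: "gauss_weight n \<in> borel_measurable borel"
  unfolding gauss_weight_def by measurable

lemma prod_std_normal_density:
  "(\<Prod>i\<in>A. std_normal_density (x i)) = gauss_weight (card A) (sqrt (\<Sum>i\<in>A. (x i)\<^sup>2))"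
proof (cases "finite A")
  case True
  then have "(\<Prod>i\<in>A. exp (- (x i)\<^sup>2 / 2)) = exp (- (\<Sum>i\<in>A. (x i)\<^sup>2) / 2)"
    by (simp add: sum_divide_distrib sum_negf flip: exp_sum)
  then show ?thesis
    by (simp add: std_normal_density_def gauss_weight_def prod_dividef power_divide sum_nonneg)
qed (simp add: gauss_weight_def)

text \<open>By Fubini both measures agree on the boxes \<open>Pi\<^sub>E A B\<close>, and these
  determine the product measure.\<close>

lemma PiM_density_lborel:
  fixes f :: "'a::euclidean_space \<Rightarrow> ennreal"
  assumes [measurable]: "f \<in> borel_measurable borel" and fin: "finite A"
    and sf: "sigma_finite_measure (density lborel f)"
  shows "PiM A (\<lambda>_. density lborel f) = density (PiM A (\<lambda>_. lborel)) (\<lambda>x. \<Prod>i\<in>A. f (x i))"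
proof -
  interpret D: product_sigma_finite "\<lambda>_. density lborel f"
    using sf by (simp add: product_sigma_finite_def)
  interpret L: product_sigma_finite "\<lambda>_. lborel :: 'a measure" ..
  show ?thesis
  proof (rule D.PiM_eqI[symmetric, OF fin])
    show "sets (density (PiM A (\<lambda>_. lborel)) (\<lambda>x. \<Prod>i\<in>A. f (x i))) = sets (PiM A (\<lambda>_. density lborel f))"
      by (simp cong: sets_PiM_cong)
    fix B assume B: "\<And>i. i \<in> A \<Longrightarrow> B i \<in> sets (density lborel f)"
    have B': "\<And>i. i \<in> A \<Longrightarrow> B i \<in> sets borel" using B by simp
    have [measurable]: "Pi\<^sub>E A B \<in> sets (PiM A (\<lambda>_. lborel :: 'a measure))"
      by (rule sets_PiM_I_finite[OF fin]) (use B in auto)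
    have "emeasure (density (PiM A (\<lambda>_. lborel)) (\<lambda>x. \<Prod>i\<in>A. f (x i))) (Pi\<^sub>E A B)
       = (\<integral>\<^sup>+x. (\<Prod>i\<in>A. f (x i)) * indicator (Pi\<^sub>E A B) x \<partial>PiM A (\<lambda>_. lborel))"
      by (subst emeasure_density) auto
    also have "\<dots> = (\<integral>\<^sup>+x. (\<Prod>i\<in>A. f (x i) * indicator (B i) (x i)) \<partial>PiM A (\<lambda>_. lborel))"
    proof (rule nn_integral_cong)
      fix x assume "x \<in> space (PiM A (\<lambda>_. lborel :: 'a measure))"
      then have "indicator (Pi\<^sub>E A B) x = (\<Prod>i\<in>A. indicator (B i) (x i) :: ennreal)"
        using fin by (auto simp: indicator_def space_PiM PiE_iff Pi_iff prod_zero_iff split: if_splits)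
      then show "(\<Prod>i\<in>A. f (x i)) * indicator (Pi\<^sub>E A B) x = (\<Prod>i\<in>A. f (x i) * indicator (B i) (x i))"
        by (simp add: prod.distrib)
    qed
    also have "\<dots> = (\<Prod>i\<in>A. \<integral>\<^sup>+x. f x * indicator (B i) x \<partial>lborel)"
      using B' by (intro L.product_nn_integral_prod[OF fin]) auto
    also have "\<dots> = (\<Prod>i\<in>A. emeasure (density lborel f) (B i))"
      by (intro prod.cong refl) (use B' in \<open>simp add: emeasure_density\<close>)
    finally show "emeasure (density (PiM A (\<lambda>_. lborel)) (\<lambda>x. \<Prod>i\<in>A. f (x i))) (Pi\<^sub>E A B) = \<dots>" .
  qed
qed

lemma PiM_std_normal:
  assumes "finite A"
  shows "PiM A (\<lambda>_. std_normal_distribution) =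
    density (PiM A (\<lambda>_. lborel)) (\<lambda>x. ennreal (gauss_weight (card A) (sqrt (\<Sum>i\<in>A. (x i)\<^sup>2))))"
proof -
  have "sigma_finite_measure std_normal_distribution"
    using prob_space_normal_density[of 1 0]
    by (simp add: prob_space_def finite_measure_def)
  then show ?thesis
    using assms by (simp add: PiM_density_lborel prod_ennreal normal_density_nonneg flip: prod_std_normal_density)
qed

text \<open>The chi distribution with \<open>n\<close> degrees of freedom; the factor
  \<open>real n * unit_ball_vol (real n)\<close> is the surface area of the unit sphere.\<close>

definition chi_density :: "nat \<Rightarrow> real \<Rightarrow> real" where
  "chi_density n s =
     (if 0 \<le> s then real n * unit_ball_vol (real n) * s ^ (n - 1) * gauss_weight n s else 0)"

lemma chi_density_nonneg [simp]: "0 \<le> chi_density n s"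
  by (simp add: chi_density_def)

lemma borel_measurable_chi_density [measurable]: "chi_density n \<in> borel_measurable borel"
  unfolding chi_density_def by measurable

lemma emeasure_lborel_power_density:
  assumes "0 < n" "0 \<le> s" "0 \<le> c"
  shows "emeasure (density lborel (\<lambda>t. ennreal (if 0 \<le> t then real n * c * t ^ (n - 1) else 0))) {..s} =
    ennreal (c * s ^ n)"
proof -
  have "(\<integral>\<^sup>+t. ennreal (real n * c * t ^ (n - 1)) * indicator {0..s} t \<partial>lborel)
     = ennreal (c * s ^ n - c * 0 ^ n)"
    by (rule nn_integral_FTC_Icc) (use assms in \<open>auto intro!: derivative_eq_intros\<close>)
  moreover have "emeasure (density lborel (\<lambda>t. ennreal (if 0 \<le> t then real n * c * t ^ (n - 1) else 0))) {..s}
    = (\<integral>\<^sup>+t. ennreal (real n * c * t ^ (n - 1)) * indicator {0..s} t \<partial>lborel)"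
    by (subst emeasure_density) (auto intro!: nn_integral_cong split: split_indicator)
  ultimately show ?thesis
    using assms by (simp add: power_0_left)
qed

text \<open>The density is the derivative in \<open>s\<close> of the volume of the ball of radius
  \<open>s\<close>. The half-lines \<open>{..s}\<close> form an intersection-stable generator, so
  the ball volumes determine the pushforward under the norm.\<close>

lemma distr_norm_PiM_lborel:
  assumes fin: "finite A" and ne: "A \<noteq> {}"
  shows "distr (PiM A (\<lambda>_. lborel)) borel (\<lambda>x. sqrt (\<Sum>i\<in>A. (x i)\<^sup>2)) =
    density lborel (\<lambda>s. ennreal (if 0 \<le> s then real (card A) * unit_ball_vol (real (card A)) * s ^ (card A - 1) else 0))"
  (is "?D = ?R")
proof (rule measure_eqI_generator_eq[where E = "range atMost" and \<Omega> = UNIV and A = "\<lambda>n::nat. {..real n}"])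
  have n: "0 < card A" using fin ne by (simp add: card_gt_0_iff)
  let ?f = "\<lambda>x::_ \<Rightarrow> real. sqrt (\<Sum>i\<in>A. (x i)\<^sup>2)"
  have meas [measurable]: "?f \<in> borel_measurable (PiM A (\<lambda>_. lborel))" by measurable
  have D: "emeasure ?D {..s} = emeasure (PiM A (\<lambda>_. lborel)) ({x. ?f x \<le> s} \<inter> space (PiM A (\<lambda>_. lborel)))" for s
    by (subst emeasure_distr) (auto simp: vimage_def)
  have pos: "emeasure ?D {..s} = ennreal (unit_ball_vol (real (card A)) * s ^ card A)" if "0 < s" for s
    using emeasure_cball_aux[OF fin that] D[of s] by simp
  \<comment> \<open>Radius 0 is handled by squeezing: the mass is below the volume of every small
    ball, which tends to 0 because \<open>card A\<close> is positive.\<close>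
  have zero: "emeasure ?D {..0} = 0"
  proof -
    have "emeasure ?D {..0} \<le> ennreal (e + 0)" if "0 < e" for e
    proof -
      have ev: "\<forall>\<^sub>F s in at_right 0. unit_ball_vol (real (card A)) * s ^ card A < e"
      proof (rule order_tendstoD(2))
        show "((\<lambda>s. unit_ball_vol (real (card A)) * s ^ card A) \<longlongrightarrow> unit_ball_vol (real (card A)) * 0 ^ card A) (at_right 0)"
          by (intro tendsto_intros)
      qed (use that n in \<open>cases "card A"; simp\<close>)
      obtain s where s: "0 < s" "unit_ball_vol (real (card A)) * s ^ card A < e"
        using eventually_happens[OF eventually_conj[OF ev eventually_at_right_less]] by auto
      have "emeasure ?D {..0} \<le> emeasure ?D {..s}" by (rule emeasure_mono) (use s in auto)
      also have "\<dots> \<le> ennreal (e + 0)" using s by (simp add: pos ennreal_leI)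
      finally show ?thesis .
    qed
    then show ?thesis using ennreal_le_epsilon[of 0 "emeasure ?D {..0}"] by simp
  qed
  show "emeasure ?D X = emeasure ?R X" if X_range: "X \<in> range atMost" for X
  proof -
    obtain s where X: "X = {..s}" using X_range by auto
    consider "s < 0" | "s = 0" | "0 < s" by linarith
    then show ?thesis
    proof cases
      case 1
      have "emeasure ?D {..s} \<le> emeasure ?D {..0}" by (rule emeasure_mono) (use 1 in auto)
      moreover have "emeasure ?R {..s} \<le> emeasure ?R {..0}" by (rule emeasure_mono) (use 1 in auto)
      ultimately show ?thesis using zero n by (simp add: X emeasure_lborel_power_density power_0_left)
    next
      case 2
      then show ?thesis using zero n by (simp add: X emeasure_lborel_power_density power_0_left)
    next
      case 3
      then show ?thesis using n by (simp add: X pos emeasure_lborel_power_density)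
    qed
  qed
  show "emeasure ?D {..real k} \<noteq> \<infinity>" for k
    using zero pos[of "real k"] by (cases "k = 0") auto
  show "(\<Union>k. {..real k}) = UNIV" using real_arch_simple by (auto simp: UN_iff)
  show "Int_stable (range (atMost :: real \<Rightarrow> _))"
    by (auto simp: Int_stable_def)
qed (auto simp: borel_eq_atMost)

text \<open>The Gaussian weight depends on the norm alone, so it passes through the pushforward and
  multiplies the radial density of Lebesgue measure.\<close>

lemma distr_norm_PiM_std_normal:
  assumes fin: "finite A" and ne: "A \<noteq> {}"
  shows "distr (PiM A (\<lambda>_. std_normal_distribution)) borel (\<lambda>x. sqrt (\<Sum>i\<in>A. (x i)\<^sup>2)) =
    density lborel (\<lambda>s. ennreal (chi_density (card A) s))"
proof -
  have "distr (PiM A (\<lambda>_. std_normal_distribution)) borel (\<lambda>x. sqrt (\<Sum>i\<in>A. (x i)\<^sup>2)) =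
     density (distr (PiM A (\<lambda>_. lborel)) borel (\<lambda>x. sqrt (\<Sum>i\<in>A. (x i)\<^sup>2))) (\<lambda>s. ennreal (gauss_weight (card A) s))"
    by (subst density_distr) (auto simp: PiM_std_normal[OF fin])
  also have "\<dots> = density lborel (\<lambda>s. ennreal (chi_density (card A) s))"
    unfolding distr_norm_PiM_lborel[OF assms]
    by (subst density_density_eq) (auto simp: chi_density_def ennreal_mult' intro!: density_cong)
  finally show ?thesis .
qed

text \<open>The total mass is read off from the fact that this is the density of a law, with no
  Gamma integral to evaluate.\<close>

lemma nn_integral_chi_density:
  assumes "0 < n"
  shows "(\<integral>\<^sup>+s. ennreal (chi_density n s) \<partial>lborel) = 1"
proof -
  interpret product_prob_space "\<lambda>_::nat. std_normal_distribution"
    using prob_space_normal_density[of 1 0] by (simp add: product_prob_space_def product_prob_space_axioms_def product_sigma_finite_def prob_space_imp_sigma_finite)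
  let ?M = "distr (PiM {..<n} (\<lambda>_. std_normal_distribution)) borel (\<lambda>x. sqrt (\<Sum>i\<in>{..<n}. (x i)\<^sup>2))"
  have "prob_space ?M"
    by (intro prob_space.prob_space_distr prob_space_PiM) (auto simp: prob_space_normal_density)
  moreover have "?M = density lborel (\<lambda>s. ennreal (chi_density n s))"
    using distr_norm_PiM_std_normal[of "{..<n}"] assms by auto
  ultimately have "emeasure (density lborel (\<lambda>s. ennreal (chi_density n s))) UNIV = 1"
    using prob_space.emeasure_space_1 by fastforce
  then show ?thesis by (simp add: emeasure_density)
qed

section \<open>The standard Gaussian measure on a Euclidean space\<close>

text \<open>One measure serves vectors, matrices and pairs alike; on \<open>real ^ 'd ^ 'n\<close>
  the norm is the Frobenius norm.\<close>

definition std_gaussian :: "'a::euclidean_space measure" where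
  "std_gaussian = density lborel (\<lambda>x. ennreal (gauss_weight DIM('a) (norm x)))"

lemma sets_std_gaussian [simp, measurable_cong]: "sets std_gaussian = sets borel"
  by (simp add: std_gaussian_def)

lemma space_std_gaussian [simp]: "space std_gaussian = UNIV"
  by (simp add: std_gaussian_def)

lemma norm_sum_orthonormal:
  fixes \<phi> :: "'i \<Rightarrow> 'a::real_inner"
  assumes "finite I" and "\<And>i j. i \<in> I \<Longrightarrow> j \<in> I \<Longrightarrow> \<phi> i \<bullet> \<phi> j = (if i = j then 1 else 0)"
  shows "norm (\<Sum>i\<in>I. x i *\<^sub>R \<phi> i) = sqrt (\<Sum>i\<in>I. (x i)\<^sup>2)"
proof -
  have "(\<Sum>i\<in>I. x i *\<^sub>R \<phi> i) \<bullet> (\<Sum>i\<in>I. x i *\<^sub>R \<phi> i) = (\<Sum>i\<in>I. \<Sum>j\<in>I. x i * (x j * (\<phi> j \<bullet> \<phi> i)))"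
    by (simp add: inner_sum_left inner_sum_right sum_distrib_left)
  also have "\<dots> = (\<Sum>i\<in>I. \<Sum>j\<in>I. if j = i then (x i)\<^sup>2 else 0)"
    by (intro sum.cong refl) (auto simp: assms(2) power2_eq_square)
  also have "\<dots> = (\<Sum>i\<in>I. (x i)\<^sup>2)"
    using assms(1) by simp
  finally show ?thesis by (simp add: norm_eq_sqrt_inner)
qed

lemma std_gaussian_eq_PiM:
  "std_gaussian = distr (PiM Basis (\<lambda>_. std_normal_distribution)) borel (\<lambda>x. \<Sum>b\<in>Basis. x b *\<^sub>R (b::'a::euclidean_space))"
proof -
  have norm: "norm (\<Sum>b\<in>Basis. x b *\<^sub>R (b::'a)) = sqrt (\<Sum>b\<in>Basis. (x b)\<^sup>2)" for x
    by (rule norm_sum_orthonormal) (auto simp: inner_Basis)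
  have "(std_gaussian :: 'a measure) = density (distr (PiM Basis (\<lambda>_. lborel)) borel (\<lambda>x. \<Sum>b\<in>Basis. x b *\<^sub>R b))
      (\<lambda>x. ennreal (gauss_weight DIM('a) (norm x)))"
    unfolding std_gaussian_def by (subst lborel_eq) simp
  also have "\<dots> = distr (PiM Basis (\<lambda>_. std_normal_distribution)) borel (\<lambda>x. \<Sum>b\<in>Basis. x b *\<^sub>R (b::'a))"
    by (subst density_distr) (auto simp: norm PiM_std_normal)
  finally show ?thesis .
qed

lemma prob_space_std_gaussian: "prob_space (std_gaussian :: 'a::euclidean_space measure)"
  unfolding std_gaussian_eq_PiM
  by (intro prob_space.prob_space_distr prob_space_PiM) (auto simp: prob_space_normal_density)

interpretation std_gaussian: prob_space "std_gaussian :: 'a::euclidean_space measure"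
  by (rule prob_space_std_gaussian)

lemma linear_borel_measurable:
  fixes f :: "'a::euclidean_space \<Rightarrow> 'b::euclidean_space"
  assumes "linear f"
  shows "f \<in> borel_measurable borel"
  using assms by (simp add: borel_measurable_continuous_onI linear_continuous_on linear_conv_bounded_linear)

text \<open>\<open>Q\<close> preserves both Lebesgue measure and the norm, of which the density is a
  function.\<close>

lemma distr_std_gaussian_orthogonal:
  fixes Q :: "'a::euclidean_space \<Rightarrow> 'a"
  assumes Q: "orthogonal_transformation Q"
  shows "distr std_gaussian borel Q = std_gaussian"
proof -
  have [measurable]: "Q \<in> borel_measurable borel"
    using Q by (intro linear_borel_measurable orthogonal_transformation_linear)
  have "distr std_gaussian borel Q = density (distr lborel borel Q) (\<lambda>x. ennreal (gauss_weight DIM('a) (norm x)))"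
    by (subst density_distr) (auto simp: std_gaussian_def orthogonal_transformation_norm[OF Q])
  then show ?thesis
    by (simp add: distr_lborel_orthogonal[OF Q] std_gaussian_def)
qed

text \<open>Dimensions and squared norms add over the two factors, so the weights multiply.
  Independence of two Gaussian objects thereby becomes a Gaussian law on the product space, where an
  orthogonal map may mix the two.\<close>

lemma std_gaussian_pair:
  "std_gaussian \<Otimes>\<^sub>M std_gaussian = (std_gaussian :: ('a::euclidean_space \<times> 'b::euclidean_space) measure)"
proof -
  have weight: "gauss_weight DIM('a) (norm x) * gauss_weight DIM('b) (norm y) =
      gauss_weight DIM('a \<times> 'b) (norm (x, y))" for x :: 'a and y :: 'b
    by (simp add: gauss_weight_def norm_prod_def power_add diff_divide_distrib flip: exp_add)
  have "(std_gaussian :: 'a measure) \<Otimes>\<^sub>M (std_gaussian :: 'b measure) =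
    density (lborel \<Otimes>\<^sub>M lborel) (\<lambda>(x,y). ennreal (gauss_weight DIM('a) (norm x)) * ennreal (gauss_weight DIM('b) (norm y)))"
    unfolding std_gaussian_def
    by (intro pair_measure_density) (auto intro!: lborel.sigma_finite_measure_axioms
        prob_space_imp_sigma_finite prob_space_std_gaussian simp flip: std_gaussian_def)
  also have "\<dots> = (std_gaussian :: ('a \<times> 'b) measure)"
    unfolding std_gaussian_def lborel_prod
    by (simp add: case_prod_unfold weight flip: ennreal_mult)
  finally show ?thesis .
qed

lemma borel_measurable_fst_borel [measurable]:
  "fst \<in> borel_measurable (borel :: ('a::second_countable_topology \<times> 'b::second_countable_topology) measure)"
  by (intro borel_measurable_continuous_onI continuous_intros)

lemma borel_measurable_snd_borel [measurable]:
  "snd \<in> borel_measurable (borel :: ('a::second_countable_topology \<times> 'b::second_countable_topology) measure)"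
  by (intro borel_measurable_continuous_onI continuous_intros)

lemma distr_std_gaussian_fst:
  "distr (std_gaussian :: ('a::euclidean_space \<times> 'b::euclidean_space) measure) borel fst = std_gaussian"
proof (rule measure_eqI)
  let ?P = "std_gaussian :: ('a \<times> 'b) measure"
  fix S assume "S \<in> sets (distr ?P borel fst)"
  then have S[measurable]: "S \<in> sets borel" by simp
  have "emeasure (distr ?P borel fst) S =
      emeasure ((std_gaussian :: 'a measure) \<Otimes>\<^sub>M (std_gaussian :: 'b measure)) (S \<times> UNIV)"
    by (subst emeasure_distr) (auto simp: std_gaussian_pair intro!: arg_cong2[where f=emeasure])
  also have "\<dots> = emeasure std_gaussian S"
    by (subst std_gaussian.emeasure_pair_measure_Times)
      (auto simp: std_gaussian.emeasure_space_1[simplified])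
  finally show "emeasure (distr ?P borel fst) S = emeasure std_gaussian S" .
qed simp

lemma distr_std_gaussian_snd:
  "distr (std_gaussian :: ('a::euclidean_space \<times> 'b::euclidean_space) measure) borel snd = std_gaussian"
proof (rule measure_eqI)
  let ?P = "std_gaussian :: ('a \<times> 'b) measure"
  fix S assume "S \<in> sets (distr ?P borel snd)"
  then have S[measurable]: "S \<in> sets borel" by simp
  have "emeasure (distr ?P borel snd) S =
      emeasure ((std_gaussian :: 'a measure) \<Otimes>\<^sub>M (std_gaussian :: 'b measure)) (UNIV \<times> S)"
    by (subst emeasure_distr) (auto simp: std_gaussian_pair intro!: arg_cong2[where f=emeasure])
  also have "\<dots> = emeasure std_gaussian S"
    by (subst std_gaussian.emeasure_pair_measure_Times)
      (auto simp: std_gaussian.emeasure_space_1[simplified])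
  finally show "emeasure (distr ?P borel snd) S = emeasure std_gaussian S" .
qed simp

text \<open>The map \<open>(x, y) \<mapsto> (x - T' (T x) + T' y, T x)\<close> is orthogonal, so no completion of \<open>T'\<close> to an
  isometry between spaces of equal dimension is needed.\<close>

lemma distr_std_gaussian_coisometry:
  fixes T :: "'a::euclidean_space \<Rightarrow> 'b::euclidean_space" and T' :: "'b \<Rightarrow> 'a"
  assumes lin: "linear T" "linear T'" and inv: "\<And>y. T (T' y) = y"
    and adj: "\<And>x y. T x \<bullet> y = x \<bullet> T' y"
  shows "distr std_gaussian borel T = std_gaussian"
proof -
  define Q where "Q = (\<lambda>(x, y). (x - T' (T x) + T' y, T x))"
  have [measurable]: "T \<in> borel_measurable borel" "T' \<in> borel_measurable borel"
    using lin by (simp_all add: linear_borel_measurable)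
  have "linear Q"
    unfolding Q_def using lin
    by (intro linearI) (auto simp: linear_add linear_scale linear_diff algebra_simps)
  moreover have "Q p \<bullet> Q p = p \<bullet> p" for p
  proof -
    obtain x y where p: "p = (x, y)" by force
    have "T x \<bullet> T z = x \<bullet> T' (T z)" for x z by (rule adj)
    moreover have "T' u \<bullet> T' v = u \<bullet> v" for u v
      using adj[of "T' u" v] inv by simp
    moreover have "x \<bullet> T' y = T x \<bullet> y" by (simp add: adj)
    ultimately show ?thesis
      by (simp add: p Q_def inner_add_left inner_add_right inner_diff_left inner_diff_right inner_commute)
  qed
  ultimately have Q: "orthogonal_transformation Q"
    by (simp add: orthogonal_transformation norm_eq_sqrt_inner)
  have [measurable]: "Q \<in> borel_measurable borel"
    using \<open>linear Q\<close> by (rule linear_borel_measurable)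
  have "distr std_gaussian borel T = distr (distr (std_gaussian :: ('a \<times> 'b) measure) borel fst) borel T"
    by (simp add: distr_std_gaussian_fst)
  \<comment> \<open>\<open>T (fst p)\<close> is \<open>snd (Q p)\<close>, and \<open>Q\<close>
    leaves the Gaussian law of the pair unchanged.\<close>
  also have "\<dots> = distr (std_gaussian :: ('a \<times> 'b) measure) borel (\<lambda>p. snd (Q p))"
    by (subst distr_distr) (auto simp: comp_def Q_def split_beta)
  also have "\<dots> = distr (distr (std_gaussian :: ('a \<times> 'b) measure) borel Q) borel snd"
    by (subst distr_distr) (auto simp: comp_def)
  also have "\<dots> = std_gaussian"
    by (simp add: distr_std_gaussian_orthogonal[OF Q] distr_std_gaussian_snd)
  finally show ?thesis .
qed

text \<open>Matching \<open>Basis\<close> with the orthonormal family \<open>\<phi>\<close> defines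
  an orthogonal \<open>Q\<close>, so independent normal coordinates in any orthonormal basis give
  the same law. The free index set serves both matrix positions and bases adapted to a
  subspace.\<close>

lemma distr_PiM_std_normal_orthonormal:
  fixes \<phi> :: "'i \<Rightarrow> 'a::euclidean_space"
  assumes fin: "finite I" and card: "card I = DIM('a)"
    and orth: "\<And>i j. i \<in> I \<Longrightarrow> j \<in> I \<Longrightarrow> \<phi> i \<bullet> \<phi> j = (if i = j then 1 else 0)"
  shows "distr (PiM I (\<lambda>_. std_normal_distribution)) borel (\<lambda>x. \<Sum>i\<in>I. x i *\<^sub>R \<phi> i) = std_gaussian"
proof -
  obtain \<beta> where \<beta>: "bij_betw \<beta> I (Basis :: 'a set)"
    using fin card finite_same_card_bij[of I "Basis :: 'a set"] by auto
  define Q where "Q v = (\<Sum>i\<in>I. (v \<bullet> \<beta> i) *\<^sub>R \<phi> i)" for v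
  have "linear Q"
    unfolding Q_def by (intro linearI) (auto simp: inner_add_left scaleR_left.add sum.distrib algebra_simps scaleR_sum_right)
  moreover have "norm (Q v) = norm v" for v
  proof -
    have "norm (Q v) = sqrt (\<Sum>i\<in>I. (v \<bullet> \<beta> i)\<^sup>2)"
      unfolding Q_def using fin orth by (rule norm_sum_orthonormal)
    also have "(\<Sum>i\<in>I. (v \<bullet> \<beta> i)\<^sup>2) = (\<Sum>b\<in>Basis. (v \<bullet> b)\<^sup>2)"
      by (rule sum.reindex_bij_betw[OF \<beta>])
    finally show ?thesis
      by (simp add: norm_eq_sqrt_inner euclidean_inner[of v v] power2_eq_square)
  qed
  ultimately have Q: "orthogonal_transformation Q"
    by (simp add: orthogonal_transformation)
  have [measurable]: "Q \<in> borel_measurable borel"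
    using \<open>linear Q\<close> by (rule linear_borel_measurable)
  let ?N = "\<lambda>_. std_normal_distribution"
  have reindex: "distr (PiM Basis ?N) (PiM I ?N) (\<lambda>x. \<lambda>i\<in>I. x (\<beta> i)) = PiM I ?N"
    using \<beta> by (intro distr_PiM_reindex) (auto simp: prob_space_normal_density bij_betw_def)
  have [measurable]: "(\<lambda>x. \<lambda>i\<in>I. x (\<beta> i)) \<in> measurable (PiM Basis ?N) (PiM I ?N)"
    using \<beta> by (intro measurable_restrict measurable_component_singleton) (auto simp: bij_betw_def)
  have Qsum: "Q (\<Sum>b\<in>Basis. x b *\<^sub>R b) = (\<Sum>i\<in>I. x (\<beta> i) *\<^sub>R \<phi> i)" for x
    unfolding Q_def using \<beta>
    by (intro sum.cong refl) (simp add: inner_sum_left_Basis bij_betwE)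
  have "distr (PiM I ?N) borel (\<lambda>x. \<Sum>i\<in>I. x i *\<^sub>R \<phi> i) =
      distr (distr (PiM Basis ?N) (PiM I ?N) (\<lambda>x. \<lambda>i\<in>I. x (\<beta> i))) borel (\<lambda>x. \<Sum>i\<in>I. x i *\<^sub>R \<phi> i)"
    by (simp add: reindex)
  also have "\<dots> = distr (PiM Basis ?N) borel (\<lambda>x. \<Sum>i\<in>I. x (\<beta> i) *\<^sub>R \<phi> i)"
    by (subst distr_distr) (auto simp: comp_def intro!: distr_cong sum.cong)
  also have "\<dots> = distr (distr (PiM Basis ?N) borel (\<lambda>x. \<Sum>b\<in>Basis. x b *\<^sub>R (b::'a))) borel Q"
    by (subst distr_distr) (auto simp: comp_def Qsum)
  also have "\<dots> = std_gaussian"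
    by (simp add: distr_std_gaussian_orthogonal[OF Q] flip: std_gaussian_eq_PiM)
  finally show ?thesis .
qed

lemma AE_std_gaussian_notin:
  fixes S :: "'a::euclidean_space set"
  assumes "negligible S" and S: "S \<in> sets borel"
  shows "AE x in std_gaussian. x \<notin> S"
proof -
  have "S \<in> null_sets lborel"
    using assms by (simp add: negligible_iff_null_sets null_sets_completion_iff)
  then have "AE x in lborel. x \<notin> S" by (rule AE_not_in)
  then show ?thesis unfolding std_gaussian_def by (subst AE_density) auto
qed

section \<open>Gaussian matrices\<close>

text \<open>A projection of a closed set may fail to be closed, but restricting \<open>y\<close> to
  a closed ball makes it closed, and countably many balls exhaust the space. Events that assert the
  existence of some \<open>y\<close> are shown measurable in this way.\<close>

lemma sets_borel_closed_projection:
  fixes T :: "('a::euclidean_space \<times> 'b::euclidean_space) set"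
  assumes "closed T"
  shows "{x. \<exists>y. (y, x) \<in> T} \<in> sets borel"
proof -
  have "{x. \<exists>y. (y, x) \<in> T} = (\<Union>n::nat. {x. \<exists>y. y \<in> cball 0 (real n) \<and> (y, x) \<in> T})"
    using real_arch_simple by (simp add: set_eq_iff) blast
  moreover have "closed {x. \<exists>y. y \<in> cball 0 (real n) \<and> (y, x) \<in> T}" for n
    by (rule closed_compact_projection) (use assms in auto)
  ultimately show ?thesis by auto
qed

lemma inner_transpose_matrix_mult:
  fixes U :: "real ^ 'e ^ 'n" and X :: "real ^ 'd ^ 'n" and Y :: "real ^ 'd ^ 'e"
  shows "(transpose U ** X) \<bullet> Y = X \<bullet> (U ** Y)"
proof -
  have "(transpose U ** X) \<bullet> Y = (\<Sum>i\<in>UNIV. \<Sum>j\<in>UNIV. \<Sum>k\<in>UNIV. U $ k $ i * X $ k $ j * Y $ i $ j)"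
    by (simp add: inner_vec_def matrix_matrix_mult_def transpose_def sum_distrib_right)
  also have "\<dots> = (\<Sum>i\<in>UNIV. \<Sum>k\<in>UNIV. \<Sum>j\<in>UNIV. U $ k $ i * X $ k $ j * Y $ i $ j)"
    by (intro sum.cong refl) (rule sum.swap)
  also have "\<dots> = (\<Sum>k\<in>UNIV. \<Sum>i\<in>UNIV. \<Sum>j\<in>UNIV. U $ k $ i * X $ k $ j * Y $ i $ j)"
    by (rule sum.swap)
  also have "\<dots> = (\<Sum>k\<in>UNIV. \<Sum>j\<in>UNIV. \<Sum>i\<in>UNIV. U $ k $ i * X $ k $ j * Y $ i $ j)"
    by (intro sum.cong refl) (rule sum.swap)
  also have "\<dots> = X \<bullet> (U ** Y)"
    by (simp add: inner_vec_def matrix_matrix_mult_def sum_distrib_left mult_ac)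
  finally show ?thesis .
qed

lemma linear_matrix_mult_left:
  fixes U :: "real ^ 'n ^ 'm"
  shows "linear (\<lambda>X :: real ^ 'd ^ 'n. U ** X)"
  by (intro linearI) (simp_all add: vec_eq_iff matrix_matrix_mult_def sum_distrib_left distrib_left sum.distrib mult_ac)

text \<open>Multiplication by \<open>U\<close> is adjoint and right inverse to
  \<open>X \<mapsto> transpose U ** X\<close>. Hence the compression of a Gaussian matrix to the
  effective coordinates is Gaussian again.\<close>

lemma distr_std_gaussian_transpose_mult:
  fixes U :: "real ^ 'e ^ 'n"
  assumes "transpose U ** U = mat 1"
  shows "distr (std_gaussian :: (real ^ 'd ^ 'n) measure) borel (\<lambda>X. transpose U ** X) = std_gaussian"
  by (rule distr_std_gaussian_coisometry[where T' = "\<lambda>Y. U ** Y"])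
    (use assms in \<open>simp_all add: linear_matrix_mult_left inner_transpose_matrix_mult matrix_mul_assoc\<close>)

text \<open>Joint independence makes the law of the family of entries a product measure, and the
  matrices \<open>axis i (axis j 1)\<close> form an orthonormal basis of the matrix space.\<close>

lemma distr_gaussian_matrix:
  fixes A :: "'w \<Rightarrow> real ^ 'd ^ 'n"
  assumes M: "prob_space M" and A: "gaussian_matrix M A"
  shows "distr M borel A = std_gaussian" and "A \<in> borel_measurable M"
proof -
  interpret prob_space M by (rule M)
  let ?X = "\<lambda>(i, j) \<omega>. A \<omega> $ i $ j" and ?I = "UNIV :: ('n \<times> 'd) set"
  let ?v = "\<lambda>x. \<Sum>p\<in>?I. x p *\<^sub>R (case p of (i, j) \<Rightarrow> axis i (axis j 1)) :: real ^ 'd ^ 'n"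
  have indep: "indep_vars (\<lambda>_. borel) ?X ?I"
    and distr: "distributed M lborel (\<lambda>\<omega>. A \<omega> $ i $ j) (\<lambda>x. ennreal (std_normal_density x))" for i j
    using A by (auto simp: gaussian_matrix_def)
  have rv: "?X p \<in> borel_measurable M" for p
    using distributed_measurable[OF distr] by (auto simp: split_beta)
  have law: "distr M borel (?X p) = std_normal_distribution" for p
    using distributed_distr_eq_density[OF distr] by (auto simp: split_beta cong: distr_cong)
  have PiM: "distr M (PiM ?I (\<lambda>_. borel)) (\<lambda>\<omega>. \<lambda>p\<in>?I. ?X p \<omega>) = PiM ?I (\<lambda>_. std_normal_distribution)"
    using indep rv by (subst (asm) indep_vars_iff_distr_eq_PiM) (auto simp: law)
  have [measurable]: "(\<lambda>\<omega>. \<lambda>p\<in>?I. ?X p \<omega>) \<in> measurable M (PiM ?I (\<lambda>_. borel))"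
    by (intro measurable_restrict rv)
  have v: "A \<omega> = ?v (\<lambda>p\<in>?I. ?X p \<omega>)" for \<omega>
  proof -
    have "?v (\<lambda>p\<in>?I. ?X p \<omega>) = (\<Sum>i\<in>UNIV. \<Sum>j\<in>UNIV. (A \<omega> $ i $ j) *\<^sub>R axis i (axis j 1))"
      by (simp add: sum.cartesian_product split_beta flip: UNIV_Times_UNIV)
    also have "\<dots> = A \<omega>"
      by (simp add: vec_eq_iff axis_def if_distrib[of "\<lambda>x. _ * (x $ _)"] if_distrib[of "\<lambda>x. x $ _"] if_distrib[of "\<lambda>x. _ * x"] sum.If_cases cong: if_cong)
    finally show ?thesis by simp
  qed
  then have v_eq: "(\<lambda>\<omega>. ?v (\<lambda>p\<in>?I. ?X p \<omega>)) = A" by (intro ext) (rule v[symmetric])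
  have [measurable]: "?v \<in> borel_measurable (PiM ?I (\<lambda>_. borel))" by measurable
  have "(\<lambda>\<omega>. ?v (\<lambda>p\<in>?I. ?X p \<omega>)) \<in> borel_measurable M"
    by measurable
  then show "A \<in> borel_measurable M" unfolding v_eq .
  have "std_gaussian = distr (PiM ?I (\<lambda>_. std_normal_distribution)) borel ?v"
    by (rule distr_PiM_std_normal_orthonormal[symmetric])
      (auto simp: inner_axis_axis card_cartesian_product split: if_splits simp flip: UNIV_Times_UNIV)
  also have "\<dots> = distr (distr M (PiM ?I (\<lambda>_. borel)) (\<lambda>\<omega>. \<lambda>p\<in>?I. ?X p \<omega>)) borel ?v"
    by (simp add: PiM)
  also have "\<dots> = distr M borel (\<lambda>\<omega>. ?v (\<lambda>p\<in>?I. ?X p \<omega>))"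
    by (subst distr_distr) (auto simp: comp_def)
  finally show "distr M borel A = std_gaussian" unfolding v_eq by simp
qed

text \<open>Exchanging column \<open>j\<close> with an independent Gaussian vector is orthogonal, so column \<open>j\<close> may be
  treated as independent of the others, whose span is a null set.\<close>

lemma AE_column_not_in_span_others:
  fixes j :: "'d::finite"
  assumes "CARD('d) < CARD('e)"
  shows "AE B in (std_gaussian :: (real ^ 'd ^ 'e) measure). \<not> (\<exists>y. y $ j = 0 \<and> B *v y = column j B)"
proof -
  let ?S = "{x :: (real ^ 'd ^ 'e) \<times> (real ^ 'e). \<exists>y. y $ j = 0 \<and> fst x *v y = snd x}"
  have "closed {z :: (real ^ 'd) \<times> (real ^ 'd ^ 'e) \<times> (real ^ 'e). fst z $ j = 0 \<and> fst (snd z) *v fst z = snd (snd z)}"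
    unfolding matrix_vector_mult_def
    by (intro closed_Collect_conj closed_Collect_eq continuous_intros)
  from sets_borel_closed_projection[OF this] have [measurable]: "?S \<in> sets borel" by simp
  have AE: "AE x in (std_gaussian :: ((real ^ 'd ^ 'e) \<times> (real ^ 'e)) measure). x \<notin> ?S"
    unfolding std_gaussian_pair[symmetric]
  proof (rule pair_sigma_finite.AE_pair_measure)
    show "AE B in std_gaussian. AE g in std_gaussian. (B, g) \<notin> ?S"
    proof (rule AE_I2)
      fix B :: "real ^ 'd ^ 'e"
      \<comment> \<open>The whole range of \<open>B\<close>, which contains the span of any choice
        of its columns, is already null because its dimension is below
        \<open>CARD('e)\<close>.\<close>
      have "dim (range ((*v) B)) \<le> CARD('d)"
        using dim_image_le[of "(*v) B" UNIV] by (simp add: matrix_vector_mul_linear)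
      then have "negligible (range ((*v) B))"
        using assms by (intro negligible_lowdim) simp
      moreover have "closed (range ((*v) B))"
        by (intro closed_subspace linear_subspace_image) (simp_all add: matrix_vector_mul_linear)
      ultimately have "AE g in std_gaussian. g \<notin> range ((*v) B)"
        by (intro AE_std_gaussian_notin) auto
      then show "AE g in std_gaussian. (B, g) \<notin> ?S"
        by eventually_elim auto
    qed
    have "{x :: (real ^ 'd ^ 'e) \<times> (real ^ 'e). x \<notin> ?S} \<in> sets borel"
      by measurable
    then show "{x \<in> space (std_gaussian \<Otimes>\<^sub>M std_gaussian). x \<notin> ?S} \<in> sets (std_gaussian \<Otimes>\<^sub>M std_gaussian)"
      unfolding std_gaussian_pair by simp
  qed (simp_all add: pair_sigma_finite_def std_gaussian.sigma_finite_measure_axioms)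
  define Q :: "(real ^ 'd ^ 'e) \<times> (real ^ 'e) \<Rightarrow> (real ^ 'd ^ 'e) \<times> (real ^ 'e)"
    where "Q = (\<lambda>(B, g). (\<chi> i k. if k = j then g $ i else B $ i $ k, column j B))"
  have "linear Q"
    unfolding Q_def by (intro linearI) (auto simp: vec_eq_iff column_def)
  moreover have "Q x \<bullet> Q x = x \<bullet> x" for x
  proof -
    obtain B g where x: "x = (B, g)" by force
    have row: "(\<Sum>k\<in>UNIV. h k) = h j + (\<Sum>k\<in>UNIV - {j}. h k)" for h :: "'d \<Rightarrow> real"
      by (rule sum.remove) auto
    show ?thesis
      by (simp add: x Q_def inner_vec_def column_def row sum.distrib)
  qed
  ultimately have Q: "orthogonal_transformation Q"
    by (simp add: orthogonal_transformation norm_eq_sqrt_inner)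
  have [measurable]: "Q \<in> borel_measurable borel"
    using \<open>linear Q\<close> by (rule linear_borel_measurable)
  have "AE x in distr std_gaussian borel Q. x \<notin> ?S"
    unfolding distr_std_gaussian_orthogonal[OF Q] by (rule AE)
  then have "AE x in std_gaussian. Q x \<notin> ?S"
    by (rule AE_distr_iff[THEN iffD1, rotated 2]) measurable
  then have "AE x in (std_gaussian :: ((real ^ 'd ^ 'e) \<times> (real ^ 'e)) measure).
      \<not> (\<exists>y. y $ j = 0 \<and> fst x *v y = column j (fst x))"
  proof eventually_elim
    case (elim x)
    \<comment> \<open>Coordinate \<open>j\<close> of \<open>y\<close> vanishes, so the exchanged
      column \<open>j\<close> does not enter the product.\<close>
    have "fst (Q x) *v y = fst x *v y" if "y $ j = 0" for y
      using that by (auto simp: Q_def vec_eq_iff matrix_vector_mult_def split_beta intro!: sum.cong)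
    then show ?case using elim by (auto simp: Q_def split_beta)
  qed
  moreover have "closed {z :: (real ^ 'd) \<times> (real ^ 'd ^ 'e). fst z $ j = 0 \<and> snd z *v fst z = column j (snd z)}"
    unfolding matrix_vector_mult_def column_def
    by (intro closed_Collect_conj closed_Collect_eq continuous_intros)
  from sets_borel_closed_projection[OF this]
  have [measurable]: "{B :: real ^ 'd ^ 'e. \<exists>y. y $ j = 0 \<and> B *v y = column j B} \<in> sets borel" by simp
  then have "{B :: real ^ 'd ^ 'e. \<not> (\<exists>y. y $ j = 0 \<and> B *v y = column j B)} \<in> sets borel"
    by (subst Collect_neg_eq) auto
  ultimately show ?thesis
    by (subst distr_std_gaussian_fst[where 'b = "real ^ 'e", symmetric], subst AE_distr_iff) auto
qed

text \<open>A kernel vector with nonzero coordinate \<open>j\<close> would express column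
  \<open>j\<close> through the other columns. This is excluded almost surely for each of the
  finitely many \<open>j\<close>, so \<open>B\<close> is almost surely injective.\<close>

lemma AE_dim_range_std_gaussian:
  assumes "CARD('d) < CARD('e)"
  shows "AE B in (std_gaussian :: (real ^ 'd ^ 'e) measure). dim (range ((*v) B)) = CARD('d)"
proof -
  have "AE B in (std_gaussian :: (real ^ 'd ^ 'e) measure). \<forall>j\<in>UNIV. \<not> (\<exists>y. y $ j = 0 \<and> B *v y = column j B)"
    by (intro AE_finite_allI AE_column_not_in_span_others assms) simp
  then show ?thesis
  proof eventually_elim
    case (elim B)
    have "inj ((*v) B)"
    proof (subst linear_injective_0; (intro allI impI)?)
      fix z assume z: "B *v z = 0"
      show "z = 0"
      proof (rule ccontr)
        assume "z \<noteq> 0"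
        then obtain j where j: "z $ j \<noteq> 0" by (auto simp: vec_eq_iff)
        \<comment> \<open>Dividing \<open>z\<close> by \<open>z $ j\<close> makes its coordinate
          \<open>j\<close> equal to 1. Subtracting it from the unit vector clears that coordinate,
          while the image stays column \<open>j\<close> because \<open>z\<close> lies in the
          kernel.\<close>
        let ?y = "axis j 1 - (1 / z $ j) *\<^sub>R z"
        have "?y $ j = 0" using j by (simp add: axis_def)
        moreover have "B *v ?y = column j B"
          by (simp add: matrix_vector_mult_diff_distrib matrix_vector_mult_scaleR z matrix_vector_mult_basis)
        ultimately show False using elim by blast
      qed
    qed (simp add: matrix_vector_mul_linear)
    then show ?case
      by (subst dim_image_eq) (auto simp: matrix_vector_mul_linear)
  qed
qed

section \<open>The ratio of two chi variables\<close>

text \<open>Rescaling reduces this to total mass 1; the half-line loses nothing, as the density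
  vanishes on negative numbers and a point is null. The formula serves to integrate
  \<open>\<sigma>\<close> out of the ratio computation.\<close>

lemma nn_integral_chi_density_halfline:
  assumes "0 < n" "0 < s"
  shows "(\<integral>\<^sup>+x. ennreal (chi_density n (s * x)) * indicator {0<..} x \<partial>lborel) = ennreal (1 / s)"
proof -
  have "ennreal s * (\<integral>\<^sup>+x. ennreal (chi_density n (s * x)) * indicator {0<..} x \<partial>lborel)
     = (\<integral>\<^sup>+x. ennreal (chi_density n x) * indicator {0<..} x \<partial>lborel)"
    using assms by (subst nn_integral_real_affine[of _ s 0])
      (auto intro!: arg_cong2[where f = "(*)"] nn_integral_cong simp: indicator_def zero_less_mult_iff)
  also have "\<dots> = (\<integral>\<^sup>+x. ennreal (chi_density n x) \<partial>lborel)"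
    using AE_lborel_singleton[of "0::real"]
    by (intro nn_integral_cong_AE) (auto simp: indicator_def chi_density_def elim!: eventually_mono)
  also have "\<dots> = 1" using assms by (simp add: nn_integral_chi_density)
  finally have eq: "ennreal s * (\<integral>\<^sup>+x. ennreal (chi_density n (s * x)) * indicator {0<..} x \<partial>lborel) = 1" .
  have "ennreal (1 / s) * (ennreal s * (\<integral>\<^sup>+x. ennreal (chi_density n (s * x)) * indicator {0<..} x \<partial>lborel)) =
     (\<integral>\<^sup>+x. ennreal (chi_density n (s * x)) * indicator {0<..} x \<partial>lborel)"
    using assms by (simp add: mult.assoc[symmetric] ennreal_mult[symmetric])
  then show ?thesis by (simp add: eq)
qed

text \<open>Surface area of the unit sphere in dimension \<open>n\<close>.\<close>

definition radial_const :: "nat \<Rightarrow> real" where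
  "radial_const n = real n * unit_ball_vol (real n)"

lemma radial_const_pos: "0 < n \<Longrightarrow> 0 < radial_const n"
  by (simp add: radial_const_def)

text \<open>On the ray \<open>\<rho> = \<sigma> * t\<close> the squares add up to
  \<open>(1 + t\<^sup>2) * \<sigma>\<^sup>2\<close>, so up to a factor depending on \<open>t\<close>
  the product is a rescaled chi density in \<open>\<sigma>\<close> with \<open>a + b\<close> degrees
  of freedom. The leading \<open>\<sigma>\<close> is the Jacobian of the substitution for
  \<open>\<rho>\<close>.\<close>

lemma chi_density_scaled_product:
  assumes "0 < a" "0 < b" "0 < \<sigma>" "0 \<le> t"
  shows "\<sigma> * (chi_density a \<sigma> * chi_density b (\<sigma> * t)) =
    radial_const a * radial_const b / radial_const (a + b) * t ^ (b - 1) / sqrt (1 + t\<^sup>2) ^ (a + b - 1) *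
      chi_density (a + b) (sqrt (1 + t\<^sup>2) * \<sigma>)"
proof -
  define s where "s = sqrt (1 + t\<^sup>2)"
  have s: "0 < s" "s\<^sup>2 = 1 + t\<^sup>2"
    by (auto simp: s_def add_pos_nonneg)
  have weight: "gauss_weight a \<sigma> * gauss_weight b (\<sigma> * t) = gauss_weight (a + b) (s * \<sigma>)"
    by (simp add: gauss_weight_def power_add power_mult_distrib s mult_exp_exp) (simp add: field_simps)
  have chi: "chi_density (a + b) (s * \<sigma>) =
      radial_const (a + b) * (s * \<sigma>) ^ (a + b - 1) * gauss_weight (a + b) (s * \<sigma>)"
    using assms s(1) by (simp add: chi_density_def radial_const_def)
  obtain a' b' where ab: "a = Suc a'" "b = Suc b'" using assms by (metis gr0_implies_Suc)
  have "\<sigma> * (chi_density a \<sigma> * chi_density b (\<sigma> * t)) =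
     radial_const a * radial_const b * t ^ (b - 1) * \<sigma> ^ (a + b - 1) * (gauss_weight a \<sigma> * gauss_weight b (\<sigma> * t))"
    using assms by (simp add: chi_density_def radial_const_def ab power_mult_distrib power_add algebra_simps)
  also have "\<dots> = radial_const a * radial_const b / radial_const (a + b) * t ^ (b - 1) / s ^ (a + b - 1) *
      chi_density (a + b) (s * \<sigma>)"
    using assms s(1) radial_const_pos[of "a + b"] by (simp add: weight chi power_mult_distrib)
  finally show ?thesis by (simp add: s_def)
qed

text \<open>Substitute \<open>\<rho> = \<sigma> t\<close>, integrate out \<open>\<sigma>\<close>, and then put \<open>t = tan x\<close>. The Gaussian normalising
  factors cancel because the chi density with \<open>a + b\<close> degrees of freedom has total mass 1.\<close>

lemma chi_ratio_ge:
  fixes r :: real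
  assumes "0 < a" "0 < b" "0 < r" "r < 1"
  shows "(\<integral>\<^sup>+\<sigma>. (\<integral>\<^sup>+\<rho>. ennreal (chi_density a \<sigma> * chi_density b \<rho>) *
            indicator {p. snd p \<le> r * sqrt ((fst p)\<^sup>2 + (snd p)\<^sup>2)} (\<sigma>, \<rho>) \<partial>lborel) \<partial>lborel)
     \<ge> ennreal (radial_const a * radial_const b / radial_const (a + b) *
          integral {0..arcsin r} (\<lambda>x. sin x ^ (b - 1) * cos x ^ (a - 1)))"
proof -
  define C where "C = radial_const a * radial_const b / radial_const (a + b)"
  have C: "0 \<le> C" using assms by (simp add: C_def radial_const_pos less_imp_le)
  let ?T = "tan (arcsin r)"
  let ?R = "{p :: real \<times> real. snd p \<le> r * sqrt ((fst p)\<^sup>2 + (snd p)\<^sup>2)}"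
  have "closed ?R" by (intro closed_Collect_le continuous_intros)
  then have [measurable]: "?R \<in> sets borel" by auto
  have phi: "0 < arcsin r" "arcsin r < pi / 2"
    using assms arcsin_less_mono[of 0 r] arcsin_lt_bounded[of r] by auto
  have T: "?T = r / sqrt (1 - r\<^sup>2)"
    using assms by (simp add: tan_def cos_arcsin)
  \<comment> \<open>In the positive quadrant the line \<open>\<rho> = \<sigma> * ?T\<close> is the
    boundary of \<open>?R\<close>, so the sector below it lies in \<open>?R\<close>.\<close>
  have in_R: "(\<sigma>, \<sigma> * t) \<in> ?R" if "0 < \<sigma>" "0 \<le> t" "t \<le> ?T" for \<sigma> t
  proof -
    have r2: "0 < 1 - r\<^sup>2" using assms by (simp add: abs_square_less_1)
    have "t\<^sup>2 \<le> (r / sqrt (1 - r\<^sup>2))\<^sup>2" using that T by (intro power_mono) auto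
    also have "\<dots> = r\<^sup>2 / (1 - r\<^sup>2)" using r2 by (simp add: power_divide)
    finally have "t\<^sup>2 * (1 - r\<^sup>2) \<le> r\<^sup>2" using r2 by (simp add: field_simps)
    then have "(\<sigma> * t)\<^sup>2 \<le> (r * sqrt (\<sigma>\<^sup>2 + (\<sigma> * t)\<^sup>2))\<^sup>2"
      using mult_left_mono[of "t\<^sup>2 * (1 - r\<^sup>2)" "r\<^sup>2" "\<sigma>\<^sup>2"] by (simp add: power_mult_distrib algebra_simps)
    then have "\<sigma> * t \<le> r * sqrt (\<sigma>\<^sup>2 + (\<sigma> * t)\<^sup>2)"
      by (rule power2_le_imp_le) (use assms in simp)
    then show ?thesis by simp
  qed
  let ?s = "\<lambda>t. sqrt (1 + t\<^sup>2)"
  \<comment> \<open>The integrand in \<open>t\<close> once \<open>\<sigma>\<close> is integrated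
    out. The exponent is \<open>a + b\<close> instead of \<open>a + b - 1\<close> because that
    integration contributes \<open>1 / ?s t\<close>.\<close>
  let ?f = "\<lambda>t. C * t ^ (b - 1) / ?s t ^ (a + b)"
  \<comment> \<open>The chain runs backwards: from the angle \<open>x\<close> to
    \<open>t = tan x\<close>, then to a double integral over \<open>\<sigma>\<close> and
    \<open>t\<close>, and last to \<open>\<sigma>\<close> and \<open>\<rho>\<close>.\<close>
  have "ennreal (C * integral {0..arcsin r} (\<lambda>x. sin x ^ (b - 1) * cos x ^ (a - 1)))
     = (\<integral>\<^sup>+x. ennreal (C * (sin x ^ (b - 1) * cos x ^ (a - 1))) * indicator {0..arcsin r} x \<partial>lborel)"
  proof (rule nn_integral_has_integral_lebesgue'[symmetric])
    fix x assume "x \<in> {0..arcsin r}"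
    then have "0 \<le> sin x" "0 \<le> cos x"
      using phi by (auto intro!: sin_ge_zero cos_ge_zero)
    then show "0 \<le> C * (sin x ^ (b - 1) * cos x ^ (a - 1))" using C by simp
  next
    have "(\<lambda>x. sin x ^ (b - 1) * cos x ^ (a - 1)) integrable_on {0..arcsin r}"
      by (intro integrable_continuous_real continuous_intros)
    then show "((\<lambda>x. C * (sin x ^ (b - 1) * cos x ^ (a - 1))) has_integral
        C * integral {0..arcsin r} (\<lambda>x. sin x ^ (b - 1) * cos x ^ (a - 1))) {0..arcsin r}"
      by (intro has_integral_mult_right integrable_integral)
  qed
  also have "\<dots> = (\<integral>\<^sup>+x. ennreal (?f (tan x) * inverse ((cos x)\<^sup>2) * indicator {0..arcsin r} x) \<partial>lborel)"
  proof (rule nn_integral_cong)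
    fix x :: real
    show "ennreal (C * (sin x ^ (b - 1) * cos x ^ (a - 1))) * indicator {0..arcsin r} x =
       ennreal (?f (tan x) * inverse ((cos x)\<^sup>2) * indicator {0..arcsin r} x)"
    proof (cases "x \<in> {0..arcsin r}")
      case True
      then have c: "0 < cos x" using phi by (intro cos_gt_zero_pi) auto
      have "1 + (tan x)\<^sup>2 = (1 / cos x)\<^sup>2"
        using c sin_cos_squared_add[of x] by (simp add: tan_def field_simps power2_eq_square)
      then have s: "?s (tan x) = 1 / cos x" using c by simp
      obtain a' b' where ab: "a = Suc a'" "b = Suc b'" using assms by (metis gr0_implies_Suc)
      have "?f (tan x) * inverse ((cos x)\<^sup>2) = C * (sin x ^ (b - 1) * cos x ^ (a - 1))"
      proof -
        have "?f (tan x) = C * tan x ^ (b - 1) / (1 / cos x) ^ (a + b)" using s by simp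
        then show ?thesis
          using c by (simp add: ab tan_def power_divide power_add field_simps power2_eq_square)
      qed
      then show ?thesis using True by simp
    qed simp
  qed
  also have "\<dots> = (\<integral>\<^sup>+t. ennreal (?f t * indicator {tan 0..?T} t) \<partial>lborel)"
  proof (rule nn_integral_substitution[symmetric])
    show "set_borel_measurable borel {tan 0..?T} ?f"
      unfolding set_borel_measurable_def by measurable
    have c: "cos x \<noteq> 0" if "x \<in> {0..arcsin r}" for x
      using that phi cos_gt_zero_pi[of x] by auto
    then show "(tan has_real_derivative inverse ((cos x)\<^sup>2)) (at x)" if "x \<in> {0..arcsin r}" for x
      using that by (intro DERIV_tan) auto
    show "continuous_on {0..arcsin r} (\<lambda>x. inverse ((cos x)\<^sup>2))"
      using c by (intro continuous_intros) auto
  qed (use phi in auto)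
  also have "\<dots> = (\<integral>\<^sup>+t. (\<integral>\<^sup>+\<sigma>. ennreal (C * t ^ (b - 1) / ?s t ^ (a + b - 1)) * indicator {0..?T} t *
      (ennreal (chi_density (a + b) (?s t * \<sigma>)) * indicator {0<..} \<sigma>) \<partial>lborel) \<partial>lborel)"
  proof (rule nn_integral_cong)
    fix t :: real
    have s: "0 < ?s t" by (simp add: add_pos_nonneg)
    have "(\<integral>\<^sup>+\<sigma>. ennreal (C * t ^ (b - 1) / ?s t ^ (a + b - 1)) * indicator {0..?T} t *
        (ennreal (chi_density (a + b) (?s t * \<sigma>)) * indicator {0<..} \<sigma>) \<partial>lborel)
      = ennreal (C * t ^ (b - 1) / ?s t ^ (a + b - 1)) * indicator {0..?T} t * ennreal (1 / ?s t)"
      using s assms by (subst nn_integral_cmult) (auto simp: nn_integral_chi_density_halfline)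
    also have "\<dots> = ennreal (?f t * indicator {tan 0..?T} t)"
    proof (cases "t \<in> {0..?T}")
      case True
      moreover have "?s t ^ (a + b) = ?s t ^ (a + b - 1) * ?s t"
        using assms by (simp flip: power_Suc2)
      ultimately show ?thesis using C s by (simp flip: ennreal_mult)
    qed simp
    finally show "ennreal (?f t * indicator {tan 0..?T} t) =
      (\<integral>\<^sup>+\<sigma>. ennreal (C * t ^ (b - 1) / ?s t ^ (a + b - 1)) * indicator {0..?T} t *
        (ennreal (chi_density (a + b) (?s t * \<sigma>)) * indicator {0<..} \<sigma>) \<partial>lborel)" by simp
  qed
  also have "\<dots> = (\<integral>\<^sup>+\<sigma>. (\<integral>\<^sup>+t. ennreal (C * t ^ (b - 1) / ?s t ^ (a + b - 1)) * indicator {0..?T} t *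
      (ennreal (chi_density (a + b) (?s t * \<sigma>)) * indicator {0<..} \<sigma>) \<partial>lborel) \<partial>lborel)"
    by (rule lborel_pair.Fubini') measurable
  \<comment> \<open>An inequality is enough: for positive \<open>\<sigma>\<close> and
    \<open>t\<close> in \<open>{0..?T}\<close> the integrands agree after the substitution, and
    elsewhere the left one is zero.\<close>
  also have "\<dots> \<le> (\<integral>\<^sup>+\<sigma>. (\<integral>\<^sup>+\<rho>. ennreal (chi_density a \<sigma> * chi_density b \<rho>) *
            indicator ?R (\<sigma>, \<rho>) \<partial>lborel) \<partial>lborel)"
  proof (rule nn_integral_mono)
    fix \<sigma> :: real
    show "(\<integral>\<^sup>+t. ennreal (C * t ^ (b - 1) / ?s t ^ (a + b - 1)) * indicator {0..?T} t *
      (ennreal (chi_density (a + b) (?s t * \<sigma>)) * indicator {0<..} \<sigma>) \<partial>lborel) \<le>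
      (\<integral>\<^sup>+\<rho>. ennreal (chi_density a \<sigma> * chi_density b \<rho>) * indicator ?R (\<sigma>, \<rho>) \<partial>lborel)"
    proof (cases "0 < \<sigma>")
      case True
      have [measurable]: "Pair \<sigma> \<in> borel_measurable borel"
        by (intro borel_measurable_continuous_onI continuous_intros)
      have "(\<integral>\<^sup>+t. ennreal (C * t ^ (b - 1) / ?s t ^ (a + b - 1)) * indicator {0..?T} t *
          (ennreal (chi_density (a + b) (?s t * \<sigma>)) * indicator {0<..} \<sigma>) \<partial>lborel)
        \<le> (\<integral>\<^sup>+t. ennreal \<sigma> * (ennreal (chi_density a \<sigma> * chi_density b (\<sigma> * t)) * indicator ?R (\<sigma>, \<sigma> * t)) \<partial>lborel)"
      proof (rule nn_integral_mono)
        fix t :: real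
        show "ennreal (C * t ^ (b - 1) / ?s t ^ (a + b - 1)) * indicator {0..?T} t *
            (ennreal (chi_density (a + b) (?s t * \<sigma>)) * indicator {0<..} \<sigma>) \<le>
          ennreal \<sigma> * (ennreal (chi_density a \<sigma> * chi_density b (\<sigma> * t)) * indicator ?R (\<sigma>, \<sigma> * t))"
        proof (cases "t \<in> {0..?T}")
          case t: True
          then have "indicator ?R (\<sigma>, \<sigma> * t) = (1 :: ennreal)"
            using in_R[OF True, of t] by simp
          moreover have "\<sigma> * (chi_density a \<sigma> * chi_density b (\<sigma> * t)) =
              C * t ^ (b - 1) / ?s t ^ (a + b - 1) * chi_density (a + b) (?s t * \<sigma>)"
            unfolding C_def using t True assms by (intro chi_density_scaled_product) auto
          ultimately show ?thesis
            using t True C by (simp flip: ennreal_mult)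
        qed simp
      qed
      also have "\<dots> = ennreal \<sigma> * (\<integral>\<^sup>+t. ennreal (chi_density a \<sigma> * chi_density b (\<sigma> * t)) * indicator ?R (\<sigma>, \<sigma> * t) \<partial>lborel)"
        by (rule nn_integral_cmult) measurable
      also have "\<dots> = (\<integral>\<^sup>+\<rho>. ennreal (chi_density a \<sigma> * chi_density b \<rho>) * indicator ?R (\<sigma>, \<rho>) \<partial>lborel)"
        using True by (subst nn_integral_real_affine[of "\<lambda>\<rho>. ennreal (chi_density a \<sigma> * chi_density b \<rho>) * indicator ?R (\<sigma>, \<rho>)" \<sigma> 0]) auto
      finally show ?thesis .
    qed simp
  qed
  finally show ?thesis by (simp add: C_def)
qed

section \<open>Evaluation of the constant and comparison with \<open>tau\<close>\<close>

text \<open>The powers of \<open>pi\<close> cancel, and applying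
  \<open>Gamma (x + 1) = x * Gamma x\<close> at \<open>x = (N - d) / 2\<close> produces the factor
  \<open>N - d\<close>.\<close>

lemma radial_const_ratio:
  assumes "0 < d" "d < N"
  shows "radial_const d * radial_const (N - d) / radial_const N =
    real (N - d) * real_binomial ((real N - 2) / 2) ((real N - real d) / 2)"
proof -
  have G: "Gamma (real n / 2 + 1) = real n / 2 * Gamma (real n / 2)" if "0 < n" for n
    using that Gamma_plus1[of "real n / 2"] by (auto simp: nonpos_Ints_def)
  have pos: "Gamma (real n / 2) > 0" if "0 < n" for n
    using that by (intro Gamma_real_pos) simp
  have pi: "pi powr (real d / 2) * pi powr (real (N - d) / 2) = pi powr (real N / 2)"
    using assms by (simp add: of_nat_diff flip: powr_add add_divide_distrib)
  have rc: "radial_const n = 2 * pi powr (real n / 2) / Gamma (real n / 2)" if "0 < n" for n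
    using that pos[OF that] by (simp add: radial_const_def unit_ball_vol_def G[OF that])
  have "radial_const d * radial_const (N - d) / radial_const N =
    2 * (pi powr (real d / 2) * pi powr (real (N - d) / 2)) / pi powr (real N / 2) *
      Gamma (real N / 2) / (Gamma (real d / 2) * Gamma (real (N - d) / 2))"
    using assms by (simp add: rc mult_ac)
  also have "\<dots> = 2 * Gamma (real N / 2) / (Gamma (real d / 2) * Gamma (real (N - d) / 2))"
    by (simp add: pi)
  also have "\<dots> = real (N - d) * (Gamma (real N / 2) / (Gamma (real (N - d) / 2 + 1) * Gamma (real d / 2)))"
    using assms by (subst G) (simp_all add: mult_ac)
  also have "Gamma (real N / 2) / (Gamma (real (N - d) / 2 + 1) * Gamma (real d / 2)) =
      real_binomial ((real N - 2) / 2) ((real N - real d) / 2)"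
    using assms by (simp add: real_binomial_def of_nat_diff) (simp add: field_simps)
  finally show ?thesis .
qed

text \<open>One cosine is kept, so that \<open>sin x ^ (b - 1) * cos x\<close> has the
  antiderivative \<open>sin x ^ b / b\<close>. The other \<open>a - 2\<close> cosines are bounded
  below by \<open>cos (arcsin r) = sqrt (1 - r\<^sup>2)\<close>.\<close>

lemma integral_sin_cos_ge:
  fixes r :: real
  assumes "0 < r" "r < 1" "2 \<le> a" "0 < b"
  shows "integral {0..arcsin r} (\<lambda>x. sin x ^ (b - 1) * cos x ^ (a - 1)) \<ge>
     r ^ b * (1 - r\<^sup>2) powr ((real a - 2) / 2) / real b"
proof -
  have phi: "0 < arcsin r" "arcsin r < pi / 2"
    using assms arcsin_less_mono[of 0 r] arcsin_lt_bounded[of r] by auto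
  have r2: "0 < 1 - r\<^sup>2" using assms by (simp add: abs_square_less_1)
  let ?c = "sqrt (1 - r\<^sup>2) ^ (a - 2)"
  have "((\<lambda>x. sin x ^ (b - 1) * cos x) has_integral
      (sin (arcsin r) ^ b / real b - sin 0 ^ b / real b)) {0..arcsin r}"
    using assms phi
    by (intro fundamental_theorem_of_calculus)
      (auto intro!: derivative_eq_intros simp: has_real_derivative_iff_has_vector_derivative[symmetric])
  then have int: "((\<lambda>x. sin x ^ (b - 1) * cos x) has_integral r ^ b / real b) {0..arcsin r}"
    using assms by (simp add: power_0_left)
  have "r ^ b / real b * ?c \<le> integral {0..arcsin r} (\<lambda>x. sin x ^ (b - 1) * cos x ^ (a - 1))"
  proof (rule has_integral_le[OF has_integral_mult_left[OF int]])
    have "(\<lambda>x. sin x ^ (b - 1) * cos x ^ (a - 1)) integrable_on {0..arcsin r}"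
      by (intro integrable_continuous_real continuous_intros)
    then show "((\<lambda>x. sin x ^ (b - 1) * cos x ^ (a - 1)) has_integral
      integral {0..arcsin r} (\<lambda>x. sin x ^ (b - 1) * cos x ^ (a - 1))) {0..arcsin r}"
      by (rule integrable_integral)
    fix x assume x: "x \<in> {0..arcsin r}"
    then have sc: "0 \<le> sin x" "0 \<le> cos x"
      using phi by (auto intro!: sin_ge_zero cos_ge_zero)
    have "cos (arcsin r) \<le> cos x" using x phi by (intro cos_monotone_0_pi_le) auto
    then have "?c \<le> cos x ^ (a - 2)"
      using assms r2 by (intro power_mono) (auto simp: cos_arcsin)
    then have "sin x ^ (b - 1) * cos x * ?c \<le> sin x ^ (b - 1) * cos x * cos x ^ (a - 2)"
      using sc by (intro mult_left_mono) auto
    also have "\<dots> = sin x ^ (b - 1) * cos x ^ (a - 1)"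
    proof -
      have "a - 1 = Suc (a - 2)" using assms by simp
      then show ?thesis by simp
    qed
    finally show "sin x ^ (b - 1) * cos x * ?c \<le> sin x ^ (b - 1) * cos x ^ (a - 1)" .
  qed
  moreover have "?c = (1 - r\<^sup>2) powr ((real a - 2) / 2)"
  proof -
    have "sqrt (1 - r\<^sup>2) = (1 - r\<^sup>2) powr (1 / 2)" using r2 by (simp add: powr_half_sqrt)
    then have "?c = (1 - r\<^sup>2) powr (1 / 2 * real (a - 2))" using r2 by (simp only: powr_power) simp
    then show ?thesis using assms by (simp add: of_nat_diff)
  qed
  ultimately show ?thesis by (simp add: mult.commute)
qed

text \<open>For \<open>d = 1\<close> the cosine factor is trivial and the two sides are equal; for
  larger \<open>d\<close> the factor \<open>N - d\<close> cancels against the denominator in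
  \<open>integral_sin_cos_ge\<close>.\<close>

lemma tau_le:
  assumes "0 < r" "r < 1" "0 < d" "d < N"
  shows "tau r d N \<le> radial_const d * radial_const (N - d) / radial_const N *
     integral {0..arcsin r} (\<lambda>x. sin x ^ (N - d - 1) * cos x ^ (d - 1))"
proof (cases "d = 1")
  case True
  then show ?thesis
    using assms by (simp add: tau_def radial_const_ratio of_nat_diff numeral_2_eq_2)
next
  case False
  let ?B = "real_binomial ((real N - 2) / 2) ((real N - real d) / 2)"
  have "0 \<le> radial_const d * radial_const (N - d) / radial_const N"
    using assms by (intro divide_nonneg_pos mult_nonneg_nonneg) (auto simp: radial_const_pos less_imp_le)
  then have "real (N - d) * ?B * (r ^ (N - d) * (1 - r\<^sup>2) powr ((real d - 2) / 2) / real (N - d)) \<le>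
     real (N - d) * ?B * integral {0..arcsin r} (\<lambda>x. sin x ^ (N - d - 1) * cos x ^ (d - 1))"
    using assms False unfolding radial_const_ratio[OF assms(3,4)]
    by (intro mult_left_mono integral_sin_cos_ge) auto
  then show ?thesis
    using assms False by (simp add: tau_def radial_const_ratio mult_ac)
qed

section \<open>The distance from a vector to the range of a Gaussian matrix\<close>

text \<open>In an orthonormal basis adapted to \<open>V\<close> and its complement, the two
  coordinate blocks of a Gaussian vector are independent and their norms have chi laws. The event
  holds whenever the complementary block has norm at most \<open>r\<close> times the whole norm, and
  \<open>chi_ratio_ge\<close> bounds that probability.\<close>

lemma emeasure_std_gaussian_near_subspace:
  fixes V :: "'a::euclidean_space set" and r :: real
  assumes V: "subspace V" and dim: "dim V = a" "0 < a" "a < DIM('a)" and r: "0 < r" "r < 1"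
  shows "emeasure std_gaussian {g. \<exists>y\<in>V. norm (y - g) \<le> r * norm g} \<ge>
     ennreal (tau r a DIM('a))"
proof -
  define b where "b = DIM('a) - a"
  obtain E1 where E1: "E1 \<subseteq> V" "pairwise orthogonal E1" "\<And>x. x \<in> E1 \<Longrightarrow> norm x = 1"
      "independent E1" "card E1 = dim V" "span E1 = V"
    using orthonormal_basis_subspace[OF V] by blast
  obtain E2 where E2: "E2 \<subseteq> V\<^sup>\<bottom>" "pairwise orthogonal E2" "\<And>x. x \<in> E2 \<Longrightarrow> norm x = 1"
      "independent E2" "card E2 = dim (V\<^sup>\<bottom>)" "span E2 = V\<^sup>\<bottom>"
    using orthonormal_basis_subspace[OF subspace_orthogonal_comp] by blast
  have fin: "finite E1" "finite E2"
    using E1(4) E2(4) by (auto intro: independent_imp_finite)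
  have perp: "x \<bullet> y = 0" if "x \<in> V" "y \<in> V\<^sup>\<bottom>" for x y
    using that by (auto simp: orthogonal_comp_def orthogonal_def)
  have orth: "x \<bullet> y = (if x = y then 1 else 0)" if "x \<in> E1 \<union> E2" "y \<in> E1 \<union> E2" for x y
  proof (cases "x = y")
    case True
    then show ?thesis using that E1(3) E2(3) by (auto simp: norm_eq_1)
  next
    case False
    then show ?thesis
      using that E1(1,2) E2(1,2) perp[of x y] perp[of y x]
      by (auto simp: pairwise_def orthogonal_def inner_commute)
  qed
  have disj: "E1 \<inter> E2 = {}"
    using orth perp E1(1) E2(1) by (metis disjoint_iff UnI1 subsetD zero_neq_one)
  have card: "card (E1 \<union> E2) = DIM('a)"
  proof -
    have "independent (E1 \<union> E2)"
    proof (rule pairwise_orthogonal_independent)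
      show "pairwise orthogonal (E1 \<union> E2)"
        unfolding pairwise_def orthogonal_def using orth by auto
      show "0 \<notin> E1 \<union> E2" using E1(3) E2(3) by fastforce
    qed
    moreover have "span (E1 \<union> E2) = UNIV"
    proof -
      have "x \<in> span (E1 \<union> E2)" for x
      proof -
        obtain y z where yz: "y \<in> span V" "\<And>w. w \<in> span V \<Longrightarrow> orthogonal z w" "x = y + z"
          using orthogonal_subspace_decomp_exists by blast
        then have "z \<in> V\<^sup>\<bottom>" by (auto simp: orthogonal_comp_def orthogonal_commute span_base)
        then have "z \<in> span E2" by (simp only: E2(6))
        moreover have "y \<in> span E1" using yz(1) by (simp only: E1(6)[symmetric] span_span)
        ultimately show ?thesis
          unfolding yz(3) using span_mono[of E1 "E1 \<union> E2"] span_mono[of E2 "E1 \<union> E2"]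
          by (intro span_add) auto
      qed
      then show ?thesis by auto
    qed
    ultimately show ?thesis by (simp flip: dim_eq_card_independent dim_span[of "E1 \<union> E2"])
  qed
  then have card2: "card E1 = a" "card E2 = b"
    using E1(5) dim fin disj by (auto simp: b_def card_Un_disjoint)
  have ne: "E1 \<noteq> {}" "E2 \<noteq> {}" using card2 dim b_def by auto
  let ?N = "\<lambda>_. std_normal_distribution"
  let ?n = "\<lambda>E x. sqrt (\<Sum>e\<in>E. (x e)\<^sup>2)"
  let ?g = "\<lambda>x. \<Sum>e\<in>E1 \<union> E2. x e *\<^sub>R e"
  let ?R = "{p :: real \<times> real. snd p \<le> r * sqrt ((fst p)\<^sup>2 + (snd p)\<^sup>2)}"
  let ?S = "{g. \<exists>y\<in>V. norm (y - g) \<le> r * norm g}"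
  have "closed ?R" by (intro closed_Collect_le continuous_intros)
  then have R[measurable]: "?R \<in> sets borel" by auto
  have "closed {p. fst p \<in> V \<and> norm (fst p - snd p) \<le> r * norm (snd p)}"
    using closed_subspace[OF V]
    by (intro closed_Collect_conj closed_Collect_le continuous_intros)
      (simp add: closed_vimage_fst vimage_def[symmetric] flip: vimage_Collect_eq)
  from sets_borel_closed_projection[OF this] have S[measurable]: "?S \<in> sets borel"
    by (simp add: Bex_def)
  have norm1: "norm (\<Sum>e\<in>E. x e *\<^sub>R e) = ?n E x" if "E \<subseteq> E1 \<union> E2" for E x
  proof (rule norm_sum_orthonormal)
    show "finite E" using that fin by (auto intro: finite_subset)
    show "i \<bullet> j = (if i = j then 1 else 0)" if "i \<in> E" "j \<in> E" for i j
      using that \<open>E \<subseteq> E1 \<union> E2\<close> by (intro orth) auto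
  qed
  have g_split: "?g x = (\<Sum>e\<in>E1. x e *\<^sub>R e) + (\<Sum>e\<in>E2. x e *\<^sub>R e)" for x
    using fin disj by (rule sum.union_disjoint)
  have sq_split: "?n (E1 \<union> E2) x = sqrt ((?n E1 x)\<^sup>2 + (?n E2 x)\<^sup>2)" for x
    using fin disj by (simp add: sum.union_disjoint sum_nonneg)
  have mem_S: "?g x \<in> ?S" if "(?n E1 x, ?n E2 x) \<in> ?R" for x
  proof -
    \<comment> \<open>The orthogonal projection of \<open>?g x\<close> onto \<open>V\<close>, at
      distance \<open>?n E2 x\<close>.\<close>
    let ?y = "\<Sum>e\<in>E1. x e *\<^sub>R e"
    have "?y - ?g x = - (\<Sum>e\<in>E2. x e *\<^sub>R e)" by (simp add: g_split)
    then have "norm (?y - ?g x) = ?n E2 x" by (simp only: norm_minus_cancel norm1[OF Un_upper2])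
    moreover have "norm (?g x) = ?n (E1 \<union> E2) x" by (rule norm1) simp
    ultimately have "norm (?y - ?g x) \<le> r * norm (?g x)"
      using that by (simp only: sq_split mem_Collect_eq fst_conv snd_conv)
    moreover have "?y \<in> V" using V E1(1) by (intro subspace_sum subspace_scale) auto
    ultimately show ?thesis by blast
  qed
  interpret product_prob_space "?N"
    using prob_space_normal_density[of 1 0] by (simp add: product_prob_space_def product_prob_space_axioms_def product_sigma_finite_def prob_space_imp_sigma_finite)
  have [measurable]: "?n E \<in> borel_measurable (PiM E ?N)" for E by measurable
  have [measurable]: "Pair \<sigma> \<in> borel_measurable borel" for \<sigma> :: real
    by (intro borel_measurable_continuous_onI continuous_intros)
  have comp: "(\<lambda>x. x e) \<in> borel_measurable (PiM (E1 \<union> E2) ?N)" if "e \<in> E1 \<union> E2" for e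
    using measurable_component_singleton[OF that, of ?N] by simp
  have g_meas: "?g \<in> borel_measurable (PiM (E1 \<union> E2) ?N)"
    by (intro borel_measurable_sum borel_measurable_scaleR comp measurable_const) auto
  have n_meas: "?n E \<in> borel_measurable (PiM (E1 \<union> E2) ?N)" if "E \<subseteq> E1 \<union> E2" for E
    using that comp
    by (intro measurable_compose[OF _ borel_measurable_sqrt] borel_measurable_sum borel_measurable_power) auto
  have [measurable]: "?R \<in> sets (borel \<Otimes>\<^sub>M borel)" unfolding borel_prod by (rule R)
  have "(\<lambda>x. (?n E1 x, ?n E2 x)) \<in> measurable (PiM (E1 \<union> E2) ?N) (borel \<Otimes>\<^sub>M borel)"
    by (intro measurable_Pair n_meas) auto
  then have R_n: "(\<lambda>x. indicator ?R (?n E1 x, ?n E2 x) :: ennreal) \<in> borel_measurable (PiM (E1 \<union> E2) ?N)"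
    by (rule measurable_compose) measurable
  \<comment> \<open>Conditional probability of \<open>?R\<close> given that the block in
    \<open>V\<close> has norm \<open>\<sigma>\<close>.\<close>
  define h :: "real \<Rightarrow> ennreal" where
    "h \<sigma> = (\<integral>\<^sup>+\<rho>. ennreal (chi_density b \<rho>) * indicator ?R (\<sigma>, \<rho>) \<partial>lborel)" for \<sigma>
  have [measurable]: "h \<in> borel_measurable borel" unfolding h_def by measurable
  have h_eq: "h \<sigma> = (\<integral>\<^sup>+y. indicator ?R (\<sigma>, ?n E2 y) \<partial>PiM E2 ?N)" for \<sigma>
  proof -
    have "h \<sigma> = (\<integral>\<^sup>+\<rho>. indicator ?R (\<sigma>, \<rho>) \<partial>density lborel (\<lambda>\<rho>. ennreal (chi_density b \<rho>)))"
      by (simp add: h_def nn_integral_density)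
    then show ?thesis
      by (simp add: nn_integral_distr flip: distr_norm_PiM_std_normal[OF fin(2) ne(2), unfolded card2])
  qed
  have "tau r a DIM('a) \<le> radial_const a * radial_const b / radial_const (a + b) *
      integral {0..arcsin r} (\<lambda>x. sin x ^ (b - 1) * cos x ^ (a - 1))"
    using tau_le[of r a "DIM('a)"] r dim by (simp add: b_def)
  then have "ennreal (tau r a DIM('a)) \<le> ennreal (radial_const a * radial_const b / radial_const (a + b) *
      integral {0..arcsin r} (\<lambda>x. sin x ^ (b - 1) * cos x ^ (a - 1)))"
    by (rule ennreal_leI)
  also have "\<dots> \<le> (\<integral>\<^sup>+\<sigma>. (\<integral>\<^sup>+\<rho>. ennreal (chi_density a \<sigma> * chi_density b \<rho>) * indicator ?R (\<sigma>, \<rho>) \<partial>lborel) \<partial>lborel)"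
    using r dim by (intro chi_ratio_ge) (auto simp: b_def)
  also have "\<dots> = (\<integral>\<^sup>+\<sigma>. ennreal (chi_density a \<sigma>) * (\<integral>\<^sup>+\<rho>. ennreal (chi_density b \<rho>) * indicator ?R (\<sigma>, \<rho>) \<partial>lborel) \<partial>lborel)"
    by (intro nn_integral_cong, subst nn_integral_cmult[symmetric]) (auto simp: ennreal_mult mult.assoc)
  also have "\<dots> = (\<integral>\<^sup>+\<sigma>. ennreal (chi_density a \<sigma>) * h \<sigma> \<partial>lborel)"
    by (simp only: h_def)
  also have "\<dots> = (\<integral>\<^sup>+\<sigma>. h \<sigma> \<partial>density lborel (\<lambda>\<sigma>. ennreal (chi_density a \<sigma>)))"
    by (simp add: nn_integral_density)
  also have "\<dots> = (\<integral>\<^sup>+x. h (?n E1 x) \<partial>PiM E1 ?N)"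
    by (simp add: nn_integral_distr flip: distr_norm_PiM_std_normal[OF fin(1) ne(1), unfolded card2])
  also have "\<dots> = (\<integral>\<^sup>+x. (\<integral>\<^sup>+y. indicator ?R (?n E1 x, ?n E2 y) \<partial>PiM E2 ?N) \<partial>PiM E1 ?N)"
    by (simp only: h_eq)
  \<comment> \<open>The index sets are disjoint, so Fubini joins the blocks into one product
    measure; each norm sees only its own part of \<open>merge\<close>.\<close>
  also have "\<dots> = (\<integral>\<^sup>+x. indicator ?R (?n E1 x, ?n E2 x) \<partial>PiM (E1 \<union> E2) ?N)"
  proof (subst product_nn_integral_fold[OF disj fin])
    have "?n E1 (merge E1 E2 (x, y)) = ?n E1 x" "?n E2 (merge E1 E2 (x, y)) = ?n E2 y" for x y
      using disj by (auto simp: merge_def intro!: sum.cong)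
    then show "(\<integral>\<^sup>+x. (\<integral>\<^sup>+y. indicator ?R (?n E1 x, ?n E2 y) \<partial>PiM E2 ?N) \<partial>PiM E1 ?N) =
      (\<integral>\<^sup>+x. (\<integral>\<^sup>+y. indicator ?R (?n E1 (merge E1 E2 (x, y)), ?n E2 (merge E1 E2 (x, y))) \<partial>PiM E2 ?N) \<partial>PiM E1 ?N)"
      by simp
  qed (rule R_n)
  also have "\<dots> \<le> (\<integral>\<^sup>+x. indicator ?S (?g x) \<partial>PiM (E1 \<union> E2) ?N)"
    using mem_S by (intro nn_integral_mono) (simp add: indicator_def)
  also have "\<dots> = (\<integral>\<^sup>+g. indicator ?S g \<partial>distr (PiM (E1 \<union> E2) ?N) borel ?g)"
    by (rule nn_integral_distr[symmetric, OF g_meas]) (intro borel_measurable_indicator, simp only: sets_distr S)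
  also have "\<dots> = emeasure (distr (PiM (E1 \<union> E2) ?N) borel ?g) ?S"
    by (rule nn_integral_indicator) (simp only: sets_distr S)
  also have "distr (PiM (E1 \<union> E2) ?N) borel ?g = std_gaussian"
    by (rule distr_PiM_std_normal_orthonormal) (use fin card orth in auto)
  finally show ?thesis .
qed

section \<open>The probability for a fixed vector and a Gaussian matrix\<close>

text \<open>A set of pairs, so that one Borel set can be sliced at a fixed matrix as well as at a
  fixed vector.\<close>

definition near_range :: "real \<Rightarrow> ((real ^ 'd ^ 'e) \<times> (real ^ 'e)) set" where
  "near_range r = {(B, v). \<exists>y. norm (B *v y - v) \<le> r * norm v}"

lemma sets_near_range [measurable]: "near_range r \<in> sets borel"
proof -
  have "closed {z :: (real ^ 'd) \<times> (real ^ 'd ^ 'e) \<times> (real ^ 'e).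
      norm (fst (snd z) *v fst z - snd (snd z)) \<le> r * norm (snd (snd z))}"
    unfolding matrix_vector_mult_def by (intro closed_Collect_le continuous_intros)
  from sets_borel_closed_projection[OF this] show ?thesis
    by (simp add: near_range_def case_prod_unfold)
qed

lemma sets_near_range_slice [measurable]:
  "{B. (B, v) \<in> near_range r} \<in> sets borel"
proof -
  have [measurable]: "(\<lambda>B. (B, v)) \<in> borel_measurable borel"
    by (intro borel_measurable_continuous_onI continuous_intros)
  show ?thesis by measurable
qed

lemma near_range_scale:
  assumes "(B, v) \<in> near_range r" "0 \<le> c"
  shows "(B, c *\<^sub>R v) \<in> near_range r"
proof -
  obtain y where y: "norm (B *v y - v) \<le> r * norm v" using assms by (auto simp: near_range_def)
  have "B *v (c *\<^sub>R y) - c *\<^sub>R v = c *\<^sub>R (B *v y - v)"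
    by (simp add: matrix_vector_mult_scaleR scaleR_diff_right)
  then have "norm (B *v (c *\<^sub>R y) - c *\<^sub>R v) = c * norm (B *v y - v)"
    using assms(2) by simp
  also have "\<dots> \<le> r * norm (c *\<^sub>R v)"
    using mult_left_mono[OF y assms(2)] assms(2) by (simp add: mult_ac)
  finally show ?thesis by (auto simp: near_range_def)
qed

text \<open>The event is invariant under scaling of \<open>v\<close>, so \<open>v\<close> may be
  scaled to the norm of \<open>w\<close> and then moved onto \<open>w\<close> by an orthogonal
  \<open>K\<close>; multiplying \<open>B\<close> by \<open>K\<close> preserves its law. Exchanging
  \<open>v\<close> and \<open>w\<close> gives equality.\<close>

lemma emeasure_near_range_le:
  fixes v w :: "real ^ 'e"
  assumes "v \<noteq> 0" and "w \<noteq> 0"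
  shows "emeasure std_gaussian {B :: real ^ 'd ^ 'e. (B, v) \<in> near_range r} \<le>
    emeasure std_gaussian {B :: real ^ 'd ^ 'e. (B, w) \<in> near_range r}"
proof -
  let ?c = "norm w / norm v"
  have "norm (?c *\<^sub>R v) = norm w" using assms by simp
  then obtain Q where Q: "orthogonal_transformation Q" "Q (?c *\<^sub>R v) = w"
    using orthogonal_transformation_exists by metis
  define K where "K = matrix Q"
  have lin: "linear Q" using Q(1) by (rule orthogonal_transformation_linear)
  have K: "K *v x = Q x" for x using lin by (simp add: K_def matrix_works)
  have "orthogonal_matrix K" using Q(1) by (simp add: K_def orthogonal_transformation_matrix)
  then have law: "distr (std_gaussian :: (real ^ 'd ^ 'e) measure) borel ((**) K) = std_gaussian"
    using distr_std_gaussian_transpose_mult[of "transpose K"]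
    by (simp add: orthogonal_matrix_def)
  have [measurable]: "(**) K \<in> borel_measurable (borel :: (real ^ 'd ^ 'e) measure)"
    by (intro linear_borel_measurable linear_matrix_mult_left)
  have sub: "(K ** B, w) \<in> near_range r" if B: "(B, v) \<in> near_range r" for B :: "real ^ 'd ^ 'e"
  proof -
    have "(B, ?c *\<^sub>R v) \<in> near_range r" using B by (rule near_range_scale) simp
    then obtain y where "norm (B *v y - ?c *\<^sub>R v) \<le> r * norm (?c *\<^sub>R v)"
      by (auto simp: near_range_def)
    moreover have "norm (B *v y - ?c *\<^sub>R v) = norm ((K ** B) *v y - w)"
      using orthogonal_transformation_norm[OF Q(1), of "B *v y - ?c *\<^sub>R v"]
      by (simp add: linear_diff[OF lin] Q(2) K flip: matrix_vector_mul_assoc del: scaleR_conv_of_real)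
    ultimately show ?thesis using \<open>norm (?c *\<^sub>R v) = norm w\<close> by (auto simp: near_range_def)
  qed
  have "emeasure std_gaussian {B :: real ^ 'd ^ 'e. (B, v) \<in> near_range r} \<le>
      emeasure std_gaussian ((**) K -` {B :: real ^ 'd ^ 'e. (B, w) \<in> near_range r} \<inter> space std_gaussian)"
    by (intro emeasure_mono measurable_sets[where A = borel]) (use sub in auto)
  also have "\<dots> = emeasure (distr std_gaussian borel ((**) K)) {B :: real ^ 'd ^ 'e. (B, w) \<in> near_range r}"
    by (rule emeasure_distr[symmetric]) auto
  finally show ?thesis by (simp add: law)
qed

text \<open>The joint probability for independent \<open>B\<close> and \<open>g\<close> is computed
  in both orders. With \<open>B\<close> fixed the bound for a subspace applies; with
  \<open>g\<close> fixed and nonzero the probability is at most that for \<open>w\<close>.\<close>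

lemma emeasure_near_range_ge:
  fixes v :: "real ^ 'e" and r :: real
  assumes "CARD('d) < CARD('e)" "0 < r" "r < 1"
  shows "ennreal (tau r CARD('d) CARD('e)) \<le>
    emeasure std_gaussian {B :: real ^ 'd ^ 'e. (B, v) \<in> near_range r}"
proof -
  interpret P: pair_sigma_finite "std_gaussian :: (real ^ 'd ^ 'e) measure" "std_gaussian :: (real ^ 'e) measure" ..
  let ?p = "\<lambda>v. emeasure std_gaussian {B :: real ^ 'd ^ 'e. (B, v) \<in> near_range r}"
  let ?X = "near_range r :: ((real ^ 'd ^ 'e) \<times> (real ^ 'e)) set"
  have X: "?X \<in> sets (std_gaussian \<Otimes>\<^sub>M std_gaussian)"
    unfolding std_gaussian_pair by simp
  have le: "ennreal (tau r CARD('d) CARD('e)) \<le> ?p w" if w: "w \<noteq> 0" for w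
  proof -
    have "AE B in (std_gaussian :: (real ^ 'd ^ 'e) measure).
        ennreal (tau r CARD('d) CARD('e)) \<le> emeasure std_gaussian (Pair B -` ?X)"
      using AE_dim_range_std_gaussian[OF assms(1)]
    proof eventually_elim
      case (elim B)
      have "subspace (range ((*v) B))"
        by (intro linear_subspace_image) (simp_all add: matrix_vector_mul_linear)
      from emeasure_std_gaussian_near_subspace[OF this elim _ _ assms(2,3)] assms(1)
      have "ennreal (tau r CARD('d) CARD('e)) \<le>
          emeasure std_gaussian {g. \<exists>y\<in>range ((*v) B). norm (y - g) \<le> r * norm g}"
        by simp
      also have "{g. \<exists>y\<in>range ((*v) B). norm (y - g) \<le> r * norm g} = Pair B -` ?X"
        by (auto simp: near_range_def)
      finally show ?case .
    qed
    then have "(\<integral>\<^sup>+B. ennreal (tau r CARD('d) CARD('e)) \<partial>(std_gaussian :: (real ^ 'd ^ 'e) measure)) \<le>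
        (\<integral>\<^sup>+B. emeasure std_gaussian (Pair B -` ?X) \<partial>std_gaussian)"
      by (rule nn_integral_mono_AE)
    also have "\<dots> = emeasure (std_gaussian \<Otimes>\<^sub>M std_gaussian) ?X"
      using X by (rule std_gaussian.emeasure_pair_measure_alt[symmetric])
    also have "\<dots> = (\<integral>\<^sup>+g. emeasure std_gaussian ((\<lambda>B. (B, g)) -` ?X) \<partial>std_gaussian)"
      using X by (rule P.emeasure_pair_measure_alt2)
    also have "\<dots> \<le> (\<integral>\<^sup>+g. ?p w \<partial>(std_gaussian :: (real ^ 'e) measure))"
    proof (rule nn_integral_mono_AE)
      have "AE g in (std_gaussian :: (real ^ 'e) measure). g \<notin> {0}"
        by (rule AE_std_gaussian_notin) simp_all
      then show "AE g in std_gaussian. emeasure std_gaussian ((\<lambda>B. (B, g)) -` ?X) \<le> ?p w"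
      proof eventually_elim
        case (elim g)
        then show ?case using emeasure_near_range_le[of g w r] w by (simp add: vimage_def)
      qed
    qed
    finally show ?thesis
      using std_gaussian.emeasure_space_1[where 'a = "real ^ 'd ^ 'e"] std_gaussian.emeasure_space_1[where 'a = "real ^ 'e"] by simp
  qed
  show ?thesis
  proof (cases "v = 0")
    case True
    \<comment> \<open>For \<open>v = 0\<close> the event is certain, through \<open>y = 0\<close>.
      It remains to see that \<open>tau\<close> is at most 1, which the bound at any nonzero vector
      shows.\<close>
    have "ennreal (tau r CARD('d) CARD('e)) \<le> ?p (axis undefined 1)"
      by (rule le) (simp add: axis_eq_0_iff)
    also have "\<dots> \<le> 1" by (rule std_gaussian.emeasure_le_1)
    also have "{B :: real ^ 'd ^ 'e. (B, v) \<in> near_range r} = UNIV"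
      using True by (auto simp: near_range_def intro!: exI[of _ 0])
    then have "1 = ?p v"
      using std_gaussian.emeasure_space_1[where 'a = "real ^ 'd ^ 'e"] by simp
    finally show ?thesis .
  qed (rule le)
qed

section \<open>From the geometric event to success of the reduced problem\<close>

text \<open>\<open>U ** transpose U\<close> is the orthogonal projection onto the span of the
  columns: the residual is orthogonal to every column because
  \<open>transpose U ** U = mat 1\<close>.\<close>

lemma varies_only_along_projection:
  fixes U :: "real ^ 'e ^ 'n"
  assumes U: "transpose U ** U = mat 1" and f: "varies_only_along f (span (columns U))"
  shows "f x = f (U *v (transpose U *v x))"
proof -
  let ?q = "U *v (transpose U *v x)"
  have q: "?q \<in> span (columns U)"
    by (rule matrix_vector_mult_in_columnspace)
  have "orthogonal (x - ?q) w" if w: "w \<in> span (columns U)" for w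
  proof (rule orthogonal_to_span[OF w])
    fix c assume "c \<in> columns U"
    then obtain k where k: "c = U *v axis k 1"
      by (auto simp: columns_def matrix_vector_mult_basis)
    have "(x - ?q) \<bullet> (U *v axis k 1) = (transpose U *v (x - ?q)) \<bullet> axis k 1"
      by (metis dot_lmul_matrix vector_transpose_matrix transpose_transpose)
    also have "transpose U *v (x - ?q) = 0"
      by (simp add: matrix_vector_mult_diff_distrib matrix_vector_mul_assoc matrix_mul_assoc U)
    finally show "orthogonal (x - ?q) c" by (simp add: k orthogonal_def)
  qed
  then have "x - ?q \<in> (span (columns U))\<^sup>\<bottom>"
    by (simp add: orthogonal_comp_def orthogonal_commute)
  with q f have "f (?q + (x - ?q)) = f ?q" by (simp only: varies_only_along_def)
  then show ?thesis by simp
qed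

lemma norm_mult_orthonormal_columns:
  fixes U :: "real ^ 'e ^ 'n"
  assumes "transpose U ** U = mat 1"
  shows "norm (U *v x) = norm x"
proof -
  have "(U *v x) \<bullet> (U *v x) = (transpose U *v (U *v x)) \<bullet> x"
    by (metis dot_lmul_matrix vector_transpose_matrix transpose_transpose)
  then show ?thesis
    by (simp add: norm_eq_sqrt_inner matrix_vector_mul_assoc assms)
qed

text \<open>The Lipschitz bound is applied to the projections onto the column span, where
  \<open>f\<close> takes the same values; the points \<open>X *v y + p\<close> and
  \<open>xstar\<close> themselves may be far apart.\<close>

lemma rp_successful_if_near_range:
  fixes f :: "real ^ 'n \<Rightarrow> real" and U :: "real ^ 'e ^ 'n" and X :: "real ^ 'd ^ 'n"
  assumes "L > 0" and lip: "L-lipschitz_on UNIV f" and U: "transpose U ** U = mat 1"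
    and f: "varies_only_along f (span (columns U))" and min: "\<forall>x. f xstar \<le> f x"
    and near: "(transpose U ** X, transpose U *v xstar - transpose U *v p) \<in> near_range r"
    and bound: "r * norm (transpose U *v xstar - transpose U *v p) \<le> \<epsilon> / L"
  shows "rp_successful \<epsilon> f X p"
proof -
  obtain y where y: "norm ((transpose U ** X) *v y - (transpose U *v xstar - transpose U *v p)) \<le> \<epsilon> / L"
    using near bound by (auto simp: near_range_def intro: order_trans)
  let ?\<pi> = "\<lambda>x. U *v (transpose U *v x)"
  have "?\<pi> (X *v y + p) - ?\<pi> xstar = U *v ((transpose U ** X) *v y - (transpose U *v xstar - transpose U *v p))"
    by (simp add: matrix_vector_right_distrib algebra_simps matrix_vector_mult_diff_distrib matrix_vector_mul_assoc[symmetric])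
  then have "dist (?\<pi> (X *v y + p)) (?\<pi> xstar) \<le> \<epsilon> / L"
    using y by (simp add: dist_norm norm_mult_orthonormal_columns[OF U])
  then have "L * dist (?\<pi> (X *v y + p)) (?\<pi> xstar) \<le> \<epsilon>"
    using \<open>L > 0\<close> by (simp add: field_simps)
  then have "dist (f (?\<pi> (X *v y + p))) (f (?\<pi> xstar)) \<le> \<epsilon>"
    using lipschitz_onD[OF lip, of "?\<pi> (X *v y + p)" "?\<pi> xstar"] by simp
  then have "f (X *v y + p) \<le> f xstar + \<epsilon>"
    unfolding dist_real_def varies_only_along_projection[OF U f, symmetric] by simp
  moreover have "(INF x. f x) = f xstar"
    using min by (intro cInf_eq_minimum) auto
  ultimately show ?thesis by (auto simp: rp_successful_def)
qed

text \<open>As a projection of a closed set the event is Borel, so \<open>measure\<close> gives its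
  probability and not the default value 0.\<close>

lemma sets_rp_successful:
  fixes f :: "real ^ 'n \<Rightarrow> real"
  assumes "continuous_on UNIV f"
  shows "{X :: real ^ 'd ^ 'n. rp_successful \<epsilon> f X p} \<in> sets borel"
proof -
  have "closed {z :: (real ^ 'd) \<times> (real ^ 'd ^ 'n). f (snd z *v fst z + p) \<le> (INF x. f x) + \<epsilon>}"
    unfolding matrix_vector_mult_def
    by (intro closed_Collect_le continuous_intros continuous_on_compose2[OF assms]) auto
  from sets_borel_closed_projection[OF this] show ?thesis
    by (simp add: rp_successful_def)
qed

theorem corollary7p5:
  fixes f :: "real ^ 'n \<Rightarrow> real"
    and U :: "real ^ 'e ^ 'n"
    and M :: "'w measure"
    and A :: "'w \<Rightarrow> real ^ 'd ^ 'n"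
    and p xstar :: "real ^ 'n"
    and L \<epsilon> Rmax :: real
  assumes "L > 0" and "L-lipschitz_on UNIV f"
    and "has_effective_dimension f CARD('e)" and "CARD('e) < CARD('n)"
    and "transpose U ** U = mat 1"
    and "effective_subspace f (span (columns U))"
    and "CARD('d) < CARD('e)"
    and "\<epsilon> > 0"
    and "prob_space M" and "gaussian_matrix M A"
    and "\<forall>x. f xstar \<le> f x"
    and "Rmax > \<epsilon> / L"
    and "norm (transpose U *v p - transpose U *v xstar) \<le> Rmax"
  shows "measure M {\<omega> \<in> space M. rp_successful \<epsilon> f (A \<omega>) p}
           \<ge> tau (\<epsilon> / (L * Rmax)) CARD('d) CARD('e)"
proof -
  interpret prob_space M by fact
  \<comment> \<open>With this choice \<open>r * Rmax = \<epsilon> / L\<close>, so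
    \<open>norm z \<le> Rmax\<close> yields the tolerance \<open>\<epsilon> / L\<close>, and
    \<open>Rmax > \<epsilon> / L\<close> says that \<open>r < 1\<close>.\<close>
  define r where "r = \<epsilon> / (L * Rmax)"
  define z where "z = transpose U *v xstar - transpose U *v p"
  have Rmax: "0 < Rmax" using assms(1,8,12) by (metis divide_pos_pos less_trans)
  have r: "0 < r" "r < 1" "r * Rmax = \<epsilon> / L"
    using assms(1,8,12) Rmax by (simp_all add: r_def field_simps)
  have "norm z \<le> Rmax" using assms(13) by (simp add: z_def norm_minus_commute)
  then have bound: "r * norm z \<le> \<epsilon> / L" using mult_left_mono[of "norm z" Rmax r] r by simp
  let ?near = "{B :: real ^ 'd ^ 'e. (B, z) \<in> near_range r}"
  let ?succ = "{X :: real ^ 'd ^ 'n. rp_successful \<epsilon> f X p}"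
  have varies: "varies_only_along f (span (columns U))"
    using assms(6) by (simp add: effective_subspace_def)
  have succ [measurable]: "?succ \<in> sets borel"
    using assms(2) by (intro sets_rp_successful lipschitz_on_continuous_on)
  have A [measurable]: "A \<in> borel_measurable M" and law: "distr M borel A = std_gaussian"
    using distr_gaussian_matrix[OF assms(9,10)] by auto
  have [measurable]: "(\<lambda>X. transpose U ** X) \<in> borel_measurable (borel :: (real ^ 'd ^ 'n) measure)"
    by (intro linear_borel_measurable linear_matrix_mult_left)
  have "ennreal (tau r CARD('d) CARD('e)) \<le> emeasure std_gaussian ?near"
    by (rule emeasure_near_range_ge) (use assms(7) r in auto)
  also have "\<dots> = emeasure (distr (std_gaussian :: (real ^ 'd ^ 'n) measure) borel (\<lambda>X. transpose U ** X)) ?near"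
    by (simp add: distr_std_gaussian_transpose_mult[OF assms(5)])
  also have "\<dots> = emeasure std_gaussian ((\<lambda>X. transpose U ** X) -` ?near \<inter> space std_gaussian)"
    by (rule emeasure_distr) auto
  also have "\<dots> \<le> emeasure std_gaussian ?succ"
    using rp_successful_if_near_range[OF assms(1,2,5) varies assms(11)] bound
    by (intro emeasure_mono) (auto simp: z_def)
  also have "\<dots> = emeasure M (A -` ?succ \<inter> space M)"
    unfolding law[symmetric] by (rule emeasure_distr) auto
  also have "A -` ?succ \<inter> space M = {\<omega> \<in> space M. rp_successful \<epsilon> f (A \<omega>) p}"
    by auto
  finally show ?thesis
    by (simp add: emeasure_eq_measure r_def ennreal_le_iff)
qed

end
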